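(* Let $n\in\mathbb{N}$, $0<\alpha<n$, $0<p<\infty$, $0<\rho<\infty$, and $\omega\in A_{\infty}^{\rm loc}$. There is a constant $C=C(n,\alpha,p,[\omega]_{A_{\infty;\rho}^{\rm loc}})>0$, depending only on the indicated parameters, such that for every positive measure $\mu$ on $\mathbb{R}^n$, $$\int_{\mathbb{R}^n}(I_{\alpha,\rho}\ast\mu)(x)^p\,\omega(x)\,dx\le C\int_{\mathbb{R}^n}M_{\alpha,\rho}\mu(x)^p\,\omega(x)\,dx .$$
   Context: $|x|_\infty=\max_i|x_i|$; $Q_r(x)=\{y:|y-x|_\infty<r\}$ (side length $2r$). Cubes are open with sides parallel to the axes; $\ell(Q)$ is the side length. A weight is a locally integrable function $\omega\ge0$ on $\mathbb{R}^n$ with $\omega>0$ a.e. For $0<\rho<\infty$, $[\omega]_{A_{\infty;\rho}^{\rm loc}}=\sup_{\ell(Q)\le\rho}\left(\frac{1}{|Q|}\int_Q\omega\,dx\right)\exp\left(\frac{1}{|Q|}\int_Q\log\omega(x)^{-1}dx\right)$, and $A_{\infty;\rho}^{\rm loc}$ is the class of weights for which this is finite; this class does not depend on $\rho$ and is denoted $A_\infty^{\rm loc}$. The local Riesz kernel is $I_{\alpha,\rho}(x)=|x|_\infty^{\alpha-n}\chi_{\{|x|_\infty<\rho\}}$, so $(I_{\alpha,\rho}\ast\mu)(x)=\int_{|x-y|_\infty<\rho}|x-y|_\infty^{\alpha-n}d\mu(y)$, and $M_{\alpha,\rho}\mu(x)=\sup_{0<r\le\rho}r^{-(n-\alpha)}\mu(Q_r(x))$.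 Positive measures are positive Borel measures. *)

theory Defs
  imports "HOL-Analysis.Analysis"
begin

text \<open>On \<open>real ^ 'n\<close> the library's \<^const>\<open>infnorm\<close> is the maximum norm (lemma \<open>infnorm_cart\<close>).\<close>

definition cube :: "real ^ 'n \<Rightarrow> real \<Rightarrow> (real ^ 'n) set" where
  "cube x r = {y. infnorm (y - x) < r}"

text \<open>All open axis-parallel cubes with side length at most \<open>\<rho>\<close>; \<open>cube x r\<close> has side length \<open>2 * r\<close>.\<close>

definition cubes_upto :: "real \<Rightarrow> (real ^ 'n) set set" where
  "cubes_upto \<rho> = {cube x r |x r. 0 < r \<and> 2 * r \<le> \<rho>}"

definition average :: "(real ^ 'n) set \<Rightarrow> (real ^ 'n \<Rightarrow> real) \<Rightarrow> real" where
  "average Q f = (LINT x:Q|lebesgue. f x) / measure lebesgue Q"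

definition weight :: "(real ^ 'n \<Rightarrow> real) \<Rightarrow> bool" where
  "weight \<omega> \<longleftrightarrow>
     (\<forall>K. compact K \<longrightarrow> \<omega> absolutely_integrable_on K) \<and>
     (\<forall>x. 0 \<le> \<omega> x) \<and> (AE x in lebesgue. 0 < \<omega> x)"

text \<open>
  For a weight \<open>\<omega>\<close>, the negative part of \<open>log (1 / \<omega>)\<close> is at most \<open>\<omega>\<close>, hence integrable on
  every cube. So the integral of \<open>log (1 / \<omega>)\<close> over a cube always exists in \<open>(-\<infinity>, \<infinity>]\<close>, and it is
  \<open>\<infinity>\<close> exactly when the function is not integrable there. The library integral would be 0 in that
  case, so the value \<open>\<infinity>\<close> is put in by hand.
\<close>

definition Ainf_loc_const :: "real \<Rightarrow> (real ^ 'n \<Rightarrow> real) \<Rightarrow> ennreal" where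
  "Ainf_loc_const \<rho> \<omega> =
     (SUP Q \<in> cubes_upto \<rho>.
        if (\<lambda>x. ln (inverse (\<omega> x))) absolutely_integrable_on Q
        then ennreal (average Q \<omega> * exp (average Q (\<lambda>x. ln (inverse (\<omega> x)))))
        else \<infinity>)"

text \<open>The class is the same for every \<open>\<rho> > 0\<close>; only the constant depends on \<open>\<rho>\<close>.\<close>

definition Ainf_loc :: "real \<Rightarrow> (real ^ 'n \<Rightarrow> real) set" where
  "Ainf_loc \<rho> = {\<omega>. weight \<omega> \<and> Ainf_loc_const \<rho> \<omega> < \<infinity>}"

text \<open>Powers with a positive real exponent on \<open>[0, \<infinity>]\<close>.\<close>

definition ennpowr :: "ennreal \<Rightarrow> real \<Rightarrow> ennreal" where
  "ennpowr t p = (if t = \<infinity> then \<infinity> else ennreal (enn2real t powr p))"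

text \<open>
  The kernel is \<open>\<infinity>\<close> at the origin (for \<open>\<alpha> < n\<close>), whereas \<open>0 powr a = 0\<close> in the library. This matters
  for measures with atoms.
\<close>

definition riesz_kernel :: "real \<Rightarrow> real \<Rightarrow> real ^ 'n \<Rightarrow> ennreal" where
  "riesz_kernel \<alpha> \<rho> x =
     (if x = 0 then \<infinity>
      else if infnorm x < \<rho> then ennreal (infnorm x powr (\<alpha> - real CARD('n)))
      else 0)"

definition riesz_potential ::
  "real \<Rightarrow> real \<Rightarrow> (real ^ 'n) measure \<Rightarrow> real ^ 'n \<Rightarrow> ennreal" where
  "riesz_potential \<alpha> \<rho> \<mu> x = (\<integral>\<^sup>+ y. riesz_kernel \<alpha> \<rho> (x - y) \<partial>\<mu>)"

definition frac_maximal ::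
  "real \<Rightarrow> real \<Rightarrow> (real ^ 'n) measure \<Rightarrow> real ^ 'n \<Rightarrow> ennreal" where
  "frac_maximal \<alpha> \<rho> \<mu> x =
     (SUP r \<in> {0<..\<rho>}. ennreal (r powr - (real CARD('n) - \<alpha>)) * emeasure \<mu> (cube x r))"

end

theory Submission
  imports Defs
begin

text \<open>
  At scales \<open>l = \<rho> / 2 ^ (k + 1)\<close> take the grid of half-open cubes of side \<open>l\<close>. Splitting the
  kernel into annuli bounds \<open>I * \<mu>\<close> by \<open>\<rho> powr (\<alpha> - n) * \<mu> (cube x \<rho>)\<close> plus the sum over \<open>k\<close> of
  \<open>a k x = l powr (\<alpha> - n) * \<mu> T\<close>, where \<open>T\<close> consists of the grid cube of \<open>x\<close> and its neighbours;
  the factor 1/2 in \<open>l\<close> makes each \<open>a k\<close> at most a multiple of the maximal function with the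
  same \<open>\<rho>\<close>. Fubini's theorem gives the Carleson condition: over a grid cube of
  generation \<open>m\<close>, the Lebesgue average of the sum of the \<open>a k\<close> with \<open>k \<ge> m\<close> is at most a constant
  times \<open>a m\<close>. Stopping at the first partial sum exceeding \<open>s\<close> then yields a good-\<open>\<lambda>\<close>
  inequality, for which it suffices that a half-measure subset of a cube has at most the fraction
  \<open>b < 1\<close> of its weight: the level is only raised from \<open>s\<close> to \<open>\<theta> * s\<close> with \<open>b * \<theta> powr p < 1\<close>,
  so neither doubling nor a reverse Hoelder inequality is needed.
\<close>

section \<open>The good-\<open>\<lambda>\<close> method\<close>

text \<open>Finiteness of \<open>a\<close> is what permits subtracting \<open>c * a\<close>; for
  \<open>a = \<infinity>\<close> and \<open>c > 0\<close> the inequality would say nothing. This is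
  the absorption step of \<open>good_lambda\<close>.\<close>

lemma ennreal_absorb:
  fixes a d :: ennreal
  assumes "a \<le> ennreal c * a + d" "a < \<infinity>" "0 \<le> c" "c < 1"
  shows "a \<le> ennreal (1 / (1 - c)) * d"
proof (cases "d = \<infinity>")
  case True
  then show ?thesis using assms by (simp add: ennreal_mult_top)
next
  case False
  then obtain d' where d: "d = ennreal d'" "0 \<le> d'" by (cases d) auto
  obtain a' where a: "a = ennreal a'" "0 \<le> a'" using assms(2) by (cases a) auto
  have "a' \<le> c * a' + d'"
    using assms a d by (simp flip: ennreal_mult ennreal_plus)
  then have "a' \<le> 1 / (1 - c) * d'"
    using assms by (simp add: field_simps)
  then show ?thesis
    using a d assms by (simp flip: ennreal_mult)
qed

lemma suminf_ennreal_Suc_le: "(\<Sum>j. f (Suc j)) \<le> (\<Sum>j. f j :: ennreal)"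
proof (rule suminf_le_const)
  show "sum (\<lambda>j. f (Suc j)) {..<J} \<le> (\<Sum>j. f j)" for J
  proof -
    have "sum (\<lambda>j. f (Suc j)) {..<J} \<le> sum f {..<Suc J}"
      unfolding sum.lessThan_Suc_shift by simp
    also have "\<dots> \<le> (\<Sum>j. f j)" by (rule sum_le_suminf) auto
    finally show ?thesis .
  qed
qed simp

text \<open>Integrals of p-th powers are replaced by sums over the geometric levels
  \<open>B / \<theta> ^ j\<close>. The hypothesis \<open>gl\<close> links each level of
  \<open>f\<close> to the next lower one at cost \<open>b\<close>, the weights change by the factor
  \<open>q\<close> in that step, and \<open>q * b < 1\<close> lets the sum for \<open>f\<close> be
  absorbed. Boundedness of \<open>f\<close> and finiteness of \<open>W\<close> make that sum
  finite.\<close>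

lemma good_lambda:
  fixes f g :: "'a \<Rightarrow> real"
  assumes meas [measurable]: "f \<in> borel_measurable W" "g \<in> borel_measurable W"
    and fin: "emeasure W (space W) < \<infinity>"
    and f: "\<And>x. 0 \<le> f x" "\<And>x. x \<in> space W \<Longrightarrow> f x \<le> B" and g: "\<And>x. 0 \<le> g x"
    and par: "0 < B" "0 < p" "1 < \<theta>" "0 \<le> b" "b * \<theta> powr p < 1" "0 < \<gamma>"
    and gl: "\<And>s. 0 < s \<Longrightarrow> emeasure W {x\<in>space W. \<theta> * s < f x}
        \<le> ennreal b * emeasure W {x\<in>space W. s < f x} + emeasure W {x\<in>space W. \<gamma> * s < g x}"
  defines "q \<equiv> \<theta> powr p"
  shows "(\<integral>\<^sup>+x. ennreal (f x powr p) \<partial>W)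
    \<le> ennreal (q * (1 / (1 - q * b) * (q * (q / (q - 1) * \<gamma> powr - p)))) * (\<integral>\<^sup>+x. ennreal (g x powr p) \<partial>W)"
proof -
  have q: "1 < q" unfolding q_def using par by simp
  have qb: "0 \<le> q * b" "q * b < 1" using par q by (auto simp: q_def mult.commute)
  define l where "l j = B / \<theta> ^ j" for j :: nat
  define v where "v j = l j powr p" for j
  have lpos: "0 < l j" for j unfolding l_def using par by simp
  have l_Suc: "l j = \<theta> * l (Suc j)" for j unfolding l_def using par by simp
  have v_Suc: "v j = q * v (Suc j)" for j
    unfolding v_def q_def using par lpos[of "Suc j"] by (subst l_Suc) (simp add: powr_mult)
  have v0: "0 \<le> v j" for j unfolding v_def by simp
  have l_anti: "l k \<le> l j" if "j \<le> k" for j k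
    unfolding l_def using par that by (intro divide_left_mono power_increasing) auto
  have v_sum: "(\<Sum>j=m..<J. v j) = (v m - v J) * (q / (q - 1))" if "m \<le> J" for m J
    using that
  proof (induction J rule: dec_induct)
    case (step n)
    then show ?case using q v_Suc[of n] by (simp add: field_simps)
  qed simp
  \<comment> \<open>A discrete layer-cake sum. It is at most \<open>q / (q - 1)\<close> times
    \<open>h x powr p\<close> where \<open>h\<close> is nonnegative; for \<open>f\<close>, which
    stays below the top level \<open>l 0 = B\<close>, it is also at least \<open>1 / q\<close> times
    that power.\<close>
  define S where "S h x = (\<Sum>j. ennreal (v j) * indicator {y. l j < h y} x)" for h :: "'a \<Rightarrow> real" and x
  have S_upper: "S h x \<le> ennreal (q / (q - 1)) * ennreal (h x powr p)" if "0 \<le> h x" for h x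
    unfolding S_def
  proof (rule suminf_le_const)
    fix J
    show "(\<Sum>j<J. ennreal (v j) * indicator {y. l j < h y} x)
      \<le> ennreal (q / (q - 1)) * ennreal (h x powr p)"
    proof (cases "\<exists>j. l j < h x")
      case False
      then show ?thesis by (auto simp: indicator_def)
    next
      case True
      \<comment> \<open>Index of the largest level below \<open>h x\<close>. Every contributing
        index is at least \<open>m\<close>, so a geometric series starting with
        \<open>v m \<le> h x powr p\<close> bounds the sum.\<close>
      define m where "m = (LEAST j. l j < h x)"
      have m: "l m < h x" unfolding m_def using True by (rule LeastI_ex)
      have below: "\<not> l j < h x" if "j < m" for j using not_less_Least that unfolding m_def by blast
      have "(\<Sum>j<J. ennreal (v j) * indicator {y. l j < h y} x) \<le> (\<Sum>j=m..<max m J. ennreal (v j))"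
      proof -
        have "(\<Sum>j<J. ennreal (v j) * indicator {y. l j < h y} x)
          = (\<Sum>j\<in>{..<J} \<inter> {m..}. ennreal (v j) * indicator {y. l j < h y} x)"
          using below by (intro sum.mono_neutral_right) (auto simp: indicator_def not_le)
        also have "\<dots> \<le> (\<Sum>j\<in>{..<J} \<inter> {m..}. ennreal (v j))"
          by (intro sum_mono) (auto simp: indicator_def)
        also have "\<dots> \<le> (\<Sum>j=m..<max m J. ennreal (v j))"
          by (intro sum_mono2) auto
        finally show ?thesis .
      qed
      also have "\<dots> = ennreal ((v m - v (max m J)) * (q / (q - 1)))"
        by (subst sum_ennreal) (simp_all add: v0 v_sum)
      also have "\<dots> \<le> ennreal (h x powr p * (q / (q - 1)))"
      proof -
        have "v m \<le> h x powr p" unfolding v_def using m lpos[of m] par by (intro powr_mono2) auto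
        then show ?thesis using v0[of "max m J"] q by (intro ennreal_leI mult_right_mono) auto
      qed
      also have "\<dots> = ennreal (q / (q - 1)) * ennreal (h x powr p)"
        using q by (subst mult.commute, subst ennreal_mult) auto
      finally show ?thesis .
    qed
  qed simp
  have S_lower: "ennreal (f x powr p) \<le> ennreal q * S f x" if x: "x \<in> space W" for x
  proof (cases "f x = 0")
    case True
    then show ?thesis using par by simp
  next
    case False
    then have pos: "0 < f x" using f[of x] by simp
    have "l \<longlonglongrightarrow> 0" unfolding l_def using par by (intro LIMSEQ_divide_realpow_zero) auto
    then have "\<exists>j. l j < f x"
      using order_tendstoD(2)[OF _ pos] by (metis eventually_sequentially order_refl)
    define m where "m = (LEAST j. l j < f x)"
    have m: "l m < f x" unfolding m_def using \<open>\<exists>j. l j < f x\<close> by (rule LeastI_ex)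
    \<comment> \<open>The level \<open>l 0 = B\<close> is not exceeded by \<open>f\<close>, so a
      preceding level \<open>l k\<close> exists. It bounds \<open>f x\<close> from above, at the
      price of one factor \<open>q\<close>.\<close>
    have "m \<noteq> 0" using m f(2)[OF x] by (cases "m = 0") (auto simp: l_def)
    then obtain k where k: "m = Suc k" by (cases m) auto
    have "f x \<le> l k" using not_less_Least[of k "\<lambda>j. l j < f x"] k unfolding m_def by auto
    then have "f x powr p \<le> v k" unfolding v_def using pos par by (intro powr_mono2) auto
    then have "f x powr p \<le> q * v m" using v_Suc[of k] k by simp
    then have "ennreal (f x powr p) \<le> ennreal q * ennreal (v m)"
      using q v0 by (simp flip: ennreal_mult)
    also have "ennreal (v m) \<le> S f x"
    proof -
      have "ennreal (v m) = (\<Sum>j\<in>{m}. ennreal (v j) * indicator {y. l j < f y} x)" using m by simp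
      also have "\<dots> \<le> S f x" unfolding S_def by (rule sum_le_suminf) auto
      finally show ?thesis .
    qed
    finally show ?thesis by (simp add: mult_left_mono)
  qed
  have S_int: "(\<integral>\<^sup>+x. S h x \<partial>W) = (\<Sum>j. ennreal (v j) * emeasure W {x\<in>space W. l j < h x})"
    if [measurable]: "h \<in> borel_measurable W" for h
  proof -
    have "(\<integral>\<^sup>+x. S h x \<partial>W) = (\<integral>\<^sup>+x. (\<Sum>j. ennreal (v j) * indicator {y\<in>space W. l j < h y} x) \<partial>W)"
      unfolding S_def by (intro nn_integral_cong suminf_cong) (auto simp: indicator_def)
    then show ?thesis by (simp add: nn_integral_suminf nn_integral_cmult_indicator)
  qed
  let ?Af = "\<integral>\<^sup>+x. S f x \<partial>W" and ?Ag = "\<integral>\<^sup>+x. S (\<lambda>x. g x / \<gamma>) x \<partial>W"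
  have Af_fin: "?Af < \<infinity>"
  proof -
    have "?Af \<le> (\<integral>\<^sup>+x. ennreal (q / (q - 1)) * ennreal (B powr p) \<partial>W)"
    proof (intro nn_integral_mono order_trans[OF S_upper])
      show "ennreal (q / (q - 1)) * ennreal (f x powr p) \<le> ennreal (q / (q - 1)) * ennreal (B powr p)" if "x \<in> space W" for x
        using f(1)[of x] f(2)[OF that] par by (intro mult_left_mono ennreal_leI powr_mono2) auto
    qed (use f in auto)
    also have "\<dots> < \<infinity>"
      using fin by (simp add: ennreal_mult_less_top)
    finally show ?thesis .
  qed
  have "?Af \<le> ennreal (q * b) * ?Af + ennreal q * ?Ag"
  proof -
    have "?Af = (\<Sum>j. ennreal (v j) * emeasure W {x\<in>space W. l j < f x})" by (simp add: S_int)
    also have "\<dots> \<le> (\<Sum>j. ennreal (q * b) * (ennreal (v (Suc j)) * emeasure W {x\<in>space W. l (Suc j) < f x})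
        + ennreal q * (ennreal (v (Suc j)) * emeasure W {x\<in>space W. l (Suc j) < g x / \<gamma>}))"
    proof (rule suminf_le)
      fix j
      \<comment> \<open>\<open>gl\<close> is used at \<open>s = l (Suc j)\<close>, where
        \<open>\<theta> * s = l j\<close>; the factor \<open>q\<close> comes from passing from
        \<open>v j\<close> to \<open>v (Suc j)\<close>.\<close>
      have "emeasure W {x\<in>space W. l j < f x} \<le> ennreal b * emeasure W {x\<in>space W. l (Suc j) < f x}
          + emeasure W {x\<in>space W. l (Suc j) < g x / \<gamma>}"
        using gl[OF lpos[of "Suc j"]] par by (simp add: l_Suc[of j] field_simps)
      then have "ennreal (v j) * emeasure W {x\<in>space W. l j < f x} \<le> (ennreal q * ennreal (v (Suc j))) *
         (ennreal b * emeasure W {x\<in>space W. l (Suc j) < f x} + emeasure W {x\<in>space W. l (Suc j) < g x / \<gamma>})"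
        using q v0 by (subst v_Suc) (auto simp: ennreal_mult intro: mult_left_mono)
      then show "ennreal (v j) * emeasure W {x\<in>space W. l j < f x} \<le>
          ennreal (q * b) * (ennreal (v (Suc j)) * emeasure W {x\<in>space W. l (Suc j) < f x})
        + ennreal q * (ennreal (v (Suc j)) * emeasure W {x\<in>space W. l (Suc j) < g x / \<gamma>})"
        using q par by (simp add: ennreal_mult distrib_left mult_ac)
    qed auto
    also have "\<dots> = ennreal (q * b) * (\<Sum>j. ennreal (v (Suc j)) * emeasure W {x\<in>space W. l (Suc j) < f x})
        + ennreal q * (\<Sum>j. ennreal (v (Suc j)) * emeasure W {x\<in>space W. l (Suc j) < g x / \<gamma>})"
      by (simp add: suminf_add[symmetric])
    also have "\<dots> \<le> ennreal (q * b) * (\<Sum>j. ennreal (v j) * emeasure W {x\<in>space W. l j < f x})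
        + ennreal q * (\<Sum>j. ennreal (v j) * emeasure W {x\<in>space W. l j < g x / \<gamma>})"
      by (intro add_mono mult_left_mono suminf_ennreal_Suc_le) auto
    finally show ?thesis by (simp add: S_int)
  qed
  then have Af: "?Af \<le> ennreal (1 / (1 - q * b)) * (ennreal q * ?Ag)"
    using Af_fin qb by (rule ennreal_absorb)
  have Ag: "?Ag \<le> ennreal (q / (q - 1) * \<gamma> powr - p) * (\<integral>\<^sup>+x. ennreal (g x powr p) \<partial>W)"
  proof -
    have "?Ag \<le> (\<integral>\<^sup>+x. ennreal (q / (q - 1) * \<gamma> powr - p) * ennreal (g x powr p) \<partial>W)"
    proof (intro nn_integral_mono order_trans[OF S_upper])
      show "ennreal (q / (q - 1)) * ennreal ((g x / \<gamma>) powr p)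
          \<le> ennreal (q / (q - 1) * \<gamma> powr - p) * ennreal (g x powr p)" for x
        using g[of x] par q by (simp add: powr_divide powr_minus field_simps flip: ennreal_mult)
    qed (use g par in auto)
    then show ?thesis by (simp add: nn_integral_cmult)
  qed
  have "(\<integral>\<^sup>+x. ennreal (f x powr p) \<partial>W) \<le> (\<integral>\<^sup>+x. ennreal q * S f x \<partial>W)"
    by (intro nn_integral_mono S_lower)
  also have "\<dots> = ennreal q * ?Af"
    unfolding S_def by (intro nn_integral_cmult) measurable
  also have "\<dots> \<le> ennreal q * (ennreal (1 / (1 - q * b)) * (ennreal q * (ennreal (q / (q - 1) * \<gamma> powr - p)
      * (\<integral>\<^sup>+x. ennreal (g x powr p) \<partial>W))))"
    using Ag by (intro mult_left_mono order_trans[OF Af]) auto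
  also have "\<dots> = ennreal (q * (1 / (1 - q * b) * (q * (q / (q - 1) * \<gamma> powr - p)))) * (\<integral>\<^sup>+x. ennreal (g x powr p) \<partial>W)"
    using q qb par by (simp add: ennreal_mult mult.assoc del: times_divide_eq_right times_divide_eq_left mult_minus_right)
  finally show ?thesis .
qed

section \<open>Sums along nested partitions\<close>

text \<open>Summing over the countably many values of \<open>i\<close> and exchanging sum and
  integral recovers the full integral. Estimates on cells, where the measure is finite, thus become
  global even if \<open>W\<close> has infinite total mass.\<close>

lemma nn_integral_le_fibres:
  fixes i :: "'a \<Rightarrow> 'c :: countable"
  assumes [measurable]: "f \<in> borel_measurable W" "g \<in> borel_measurable W" "i \<in> W \<rightarrow>\<^sub>M count_space UNIV"
    and le: "\<And>c. (\<integral>\<^sup>+x. f x * indicator {x \<in> space W. i x = c} x \<partial>W)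
      \<le> (\<integral>\<^sup>+x. g x * indicator {x \<in> space W. i x = c} x \<partial>W)"
  shows "(\<integral>\<^sup>+x. f x \<partial>W) \<le> (\<integral>\<^sup>+x. g x \<partial>W)"
proof -
  have split: "(\<integral>\<^sup>+x. h x \<partial>W) = (\<integral>\<^sup>+c. (\<integral>\<^sup>+x. h x * indicator {x \<in> space W. i x = c} x \<partial>W) \<partial>count_space UNIV)"
    if [measurable]: "h \<in> borel_measurable W" for h
  proof -
    have "(\<integral>\<^sup>+c. (\<integral>\<^sup>+x. h x * indicator {x \<in> space W. i x = c} x \<partial>W) \<partial>count_space UNIV)
      = (\<integral>\<^sup>+x. (\<integral>\<^sup>+c. h x * indicator {x \<in> space W. i x = c} x \<partial>count_space UNIV) \<partial>W)"
      by (rule nn_integral_count_space_nn_integral[symmetric]) auto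
    also have "\<dots> = (\<integral>\<^sup>+x. h x \<partial>W)"
    proof (rule nn_integral_cong)
      fix x assume "x \<in> space W"
      then have "(\<integral>\<^sup>+c. h x * indicator {x \<in> space W. i x = c} x \<partial>count_space UNIV)
        = (\<integral>\<^sup>+c. h x * indicator {i x} c \<partial>count_space UNIV)"
        by (intro nn_integral_cong) (auto simp: indicator_def)
      then show "(\<integral>\<^sup>+c. h x * indicator {x \<in> space W. i x = c} x \<partial>count_space UNIV) = h x"
        by (simp add: nn_integral_cmult)
    qed
    finally show ?thesis by simp
  qed
  show ?thesis by (subst (1 2) split) (auto intro!: nn_integral_mono le)
qed

text \<open>The constant of \<open>good_lambda\<close> for
  \<open>\<theta> = b powr (- 1 / (2 * p))\<close>, so that \<open>q = \<theta> powr p\<close> and,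
  for \<open>0 < b < 1\<close>, \<open>b * q = b powr (1 / 2) < 1\<close>. The value
  \<open>\<gamma> = (\<theta> - 1) / (2 * A)\<close> is the threshold of
  \<open>sum_good_lambda\<close> at \<open>\<eta> = \<theta> - 1\<close>.\<close>

definition good_lambda_const :: "real \<Rightarrow> real \<Rightarrow> real \<Rightarrow> real" where
  "good_lambda_const b A p = (let q = b powr (- 1 / 2); \<gamma> = (b powr (- 1 / (2 * p)) - 1) / (2 * A)
     in q * (1 / (1 - q * b) * (q * (q / (q - 1) * \<gamma> powr - p))))"

text \<open>\<open>M\<close> stands for Lebesgue measure and \<open>W\<close> for the weighted
  measure. Cells of generation \<open>k\<close> are encoded as fibres of \<open>ix k\<close>, which
  makes the partitions countable and the cells measurable at once. The A_infinity condition enters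
  through \<open>half\<close>.\<close>

locale nested_partitions =
  fixes M W :: "'a measure" and ix :: "nat \<Rightarrow> 'a \<Rightarrow> 'c :: countable" and b :: real
  assumes space_M: "space M = UNIV" and sets_W: "sets W = sets M"
    and ix_measurable [measurable]: "\<And>k. ix k \<in> M \<rightarrow>\<^sub>M count_space UNIV"
    and ix_refine: "\<And>k x y. ix (Suc k) x = ix (Suc k) y \<Longrightarrow> ix k x = ix k y"
    and cell_finite: "\<And>k x. emeasure W {y. ix k y = ix k x} < \<infinity>"
    and half: "\<And>k x E. E \<in> sets M \<Longrightarrow> E \<subseteq> {y. ix k y = ix k x} \<Longrightarrow>
        2 * emeasure M E \<le> emeasure M {y. ix k y = ix k x} \<Longrightarrow>
        emeasure W E \<le> ennreal b * emeasure W {y. ix k y = ix k x}"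
    and b: "0 < b" "b < 1"
begin

lemma space_W: "space W = UNIV"
  using sets_W space_M sets_eq_imp_space_eq by metis

lemma measurable_W_iff: "f \<in> W \<rightarrow>\<^sub>M K \<longleftrightarrow> f \<in> M \<rightarrow>\<^sub>M K"
  by (simp cong: measurable_cong_sets add: sets_W)

lemma ix_refine_le: "k \<le> m \<Longrightarrow> ix m x = ix m y \<Longrightarrow> ix k x = ix k y"
  by (induction m rule: dec_induct) (auto dest: ix_refine)

lemma emeasure_le_cells:
  assumes EU: "E \<in> sets M" "U \<in> sets M" "0 \<le> b"
    and le: "\<And>x. emeasure W (E \<inter> {y. ix m y = ix m x}) \<le> ennreal b * emeasure W (U \<inter> {y. ix m y = ix m x})"
  shows "emeasure W E \<le> ennreal b * emeasure W U"
proof -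
  have [measurable]: "E \<in> sets W" "U \<in> sets W" "ix m \<in> W \<rightarrow>\<^sub>M count_space UNIV"
    using EU by (simp_all add: sets_W measurable_W_iff)
  have eq: "(\<integral>\<^sup>+x. r * indicator H x * indicator {x \<in> space W. ix m x = c} x \<partial>W) = r * emeasure W (H \<inter> {y. ix m y = c})"
    if [measurable]: "H \<in> sets W" for r H c
  proof -
    have [measurable]: "{y. ix m y = c} \<in> sets W"
      using measurable_sets[of "ix m" W "count_space UNIV" "{c}"] by (simp add: space_W vimage_def)
    have "(\<integral>\<^sup>+x. r * indicator H x * indicator {x \<in> space W. ix m x = c} x \<partial>W)
        = (\<integral>\<^sup>+x. r * indicator (H \<inter> {y. ix m y = c}) x \<partial>W)"
      by (intro nn_integral_cong) (auto simp: indicator_def)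
    then show ?thesis by (simp add: nn_integral_cmult_indicator)
  qed
  have "(\<integral>\<^sup>+x. 1 * indicator E x \<partial>W) \<le> (\<integral>\<^sup>+x. ennreal b * indicator U x \<partial>W)"
  proof (rule nn_integral_le_fibres[where i = "ix m"])
    fix c
    show "(\<integral>\<^sup>+x. 1 * indicator E x * indicator {x \<in> space W. ix m x = c} x \<partial>W)
      \<le> (\<integral>\<^sup>+x. ennreal b * indicator U x * indicator {x \<in> space W. ix m x = c} x \<partial>W)"
    proof (subst (1 2) eq)
      show "1 * emeasure W (E \<inter> {y. ix m y = c}) \<le> ennreal b * emeasure W (U \<inter> {y. ix m y = c})"
      proof (cases "\<exists>x. ix m x = c")
        case True
        then show ?thesis using le by auto
      next
        case False
        then have "{y. ix m y = c} = {}" by auto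
        then show ?thesis by simp
      qed
    qed auto
  qed auto
  then show ?thesis by (simp add: nn_integral_cmult_indicator)
qed

context
  fixes a :: "nat \<Rightarrow> 'a \<Rightarrow> real" and A :: real and N :: nat
  assumes a_measurable [measurable]: "\<And>k. a k \<in> borel_measurable M"
    and a_nonneg: "\<And>k x. 0 \<le> a k x"
    and a_const: "\<And>k x y. ix k x = ix k y \<Longrightarrow> a k x = a k y"
    and A: "0 < A"
    and carleson: "\<And>m x. m < N \<Longrightarrow> (\<integral>\<^sup>+y. ennreal (\<Sum>k=m..<N. a k y) * indicator {y. ix m y = ix m x} y \<partial>M)
      \<le> ennreal (A * a m x) * emeasure M {y. ix m y = ix m x}"
begin

text \<open>
  The set where the sum exceeds \<open>s\<close> is split according to the first partial sum exceeding \<open>s\<close>; each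
  part is a union of cells, on which the Carleson condition and Markov's inequality apply.
\<close>

lemma sum_good_lambda:
  assumes s: "0 < s" and \<eta>: "0 < \<eta>"
  shows "emeasure W {y. ix 0 y = c \<and> (1 + \<eta>) * s < (\<Sum>k<N. a k y) \<and> (\<forall>k<N. a k y \<le> \<eta> / (2 * A) * s)}
    \<le> ennreal b * emeasure W {y. ix 0 y = c \<and> s < (\<Sum>k<N. a k y)}"
proof -
  define E where "E = {y. ix 0 y = c \<and> (1 + \<eta>) * s < (\<Sum>k<N. a k y) \<and> (\<forall>k<N. a k y \<le> \<eta> / (2 * A) * s)}"
  define V where "V m = {y. ix 0 y = c \<and> (\<Sum>k<m. a k y) \<le> s \<and> s < (\<Sum>k<Suc m. a k y)}" for m
  have [measurable]: "Measurable.pred M (\<lambda>y. ix 0 y = c)"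
    by (rule pred_eq_const1[where N = "count_space UNIV"]) auto
  have E [measurable]: "E \<in> sets M"
  proof -
    have "{y \<in> space M. ix 0 y = c \<and> (1 + \<eta>) * s < (\<Sum>k<N. a k y) \<and> (\<forall>k<N. a k y \<le> \<eta> / (2 * A) * s)} \<in> sets M"
      by measurable
    then show ?thesis by (simp add: E_def space_M)
  qed
  have V [measurable]: "V m \<in> sets M" for m
  proof -
    have "{y \<in> space M. ix 0 y = c \<and> (\<Sum>k<m. a k y) \<le> s \<and> s < (\<Sum>k<Suc m. a k y)} \<in> sets M"
      by measurable
    then show ?thesis by (simp add: V_def space_M)
  qed
  have mono: "(\<Sum>k<m. a k y) \<le> (\<Sum>k<n. a k y)" if "m \<le> n" for m n y
    using that a_nonneg by (intro sum_mono2) auto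
  have V_UN: "{y. ix 0 y = c \<and> s < (\<Sum>k<N. a k y)} = (\<Union>m<N. V m)"
  proof (intro set_eqI iffI)
    fix y assume y: "y \<in> {y. ix 0 y = c \<and> s < (\<Sum>k<N. a k y)}"
    define m where "m = (LEAST m. s < (\<Sum>k<m. a k y))"
    have m: "s < (\<Sum>k<m. a k y)" unfolding m_def by (rule LeastI[of _ N]) (use y in auto)
    have "m \<le> N" unfolding m_def by (rule Least_le) (use y in auto)
    moreover have "m \<noteq> 0" using m s by (cases "m = 0") auto
    ultimately obtain n where n: "m = Suc n" "n < N" by (cases m) auto
    have "\<not> s < (\<Sum>k<n. a k y)" using n not_less_Least[of n "\<lambda>m. s < (\<Sum>k<m. a k y)"] unfolding m_def by simp
    then show "y \<in> (\<Union>m<N. V m)" using n m y by (auto simp: V_def not_less intro!: bexI[of _ n])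
  next
    fix y assume "y \<in> (\<Union>m<N. V m)"
    then obtain m where "m < N" "y \<in> V m" by auto
    then show "y \<in> {y. ix 0 y = c \<and> s < (\<Sum>k<N. a k y)}"
      using mono[of "Suc m" N y] by (auto simp: V_def)
  qed
  have V_disj: "disjoint_family_on V {..<N}"
  proof -
    have "V m \<inter> V n = {}" if "m < n" for m n
    proof -
      have "\<not> (y \<in> V m \<and> y \<in> V n)" for y
        using that mono[of "Suc m" n y] by (auto simp: V_def simp del: sum.lessThan_Suc)
      then show ?thesis by blast
    qed
    then show ?thesis unfolding disjoint_family_on_def by (metis inf_commute linorder_neqE_nat)
  qed
  have V_bound: "emeasure W (E \<inter> V m) \<le> ennreal b * emeasure W (V m)" if "m < N" for m
  proof (rule emeasure_le_cells[where m = m])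
    fix x
    let ?c = "{y. ix m y = ix m x}"
    have c_sets [measurable]: "?c \<in> sets M"
      using measurable_sets[of "ix m" M "count_space UNIV" "{ix m x}"] by (simp add: space_M vimage_def)
    show "emeasure W (E \<inter> V m \<inter> ?c) \<le> ennreal b * emeasure W (V m \<inter> ?c)"
    proof (cases "E \<inter> V m \<inter> ?c = {}")
      case False
      then obtain z where z: "z \<in> E" "z \<in> V m" "ix m z = ix m x" by auto
      have same: "ix k y = ix k z" if "y \<in> ?c" "k \<le> m" for y k
        using that z ix_refine_le[of k m y z] by auto
      have sum_same: "(\<Sum>k<n. a k y) = (\<Sum>k<n. a k z)" if "y \<in> ?c" "n \<le> Suc m" for y n
        using that by (intro sum.cong refl a_const same) auto
      \<comment> \<open>The partial sums through index \<open>m\<close> are constant on a cell of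
        generation \<open>m\<close>, so the single point \<open>z\<close> forces the whole cell into
        \<open>V m\<close>.\<close>
      have "?c \<subseteq> V m"
      proof
        fix y assume y: "y \<in> ?c"
        then show "y \<in> V m"
          using z same[OF y, of 0] sum_same[OF y, of m] sum_same[OF y, of "Suc m"] unfolding V_def by auto
      qed
      then have Vc: "V m \<inter> ?c = ?c" by auto
      have am: "a m x \<le> \<eta> / (2 * A) * s" using z \<open>m < N\<close> a_const[of m z x] by (auto simp: E_def)
      \<comment> \<open>Before index \<open>m\<close> the sum is at most \<open>s\<close>, in total
        it exceeds \<open>(1 + \<eta>) * s\<close>; the tail starting at \<open>m\<close> therefore
        carries at least \<open>\<eta> * s\<close>.\<close>
      have rest: "1 \<le> ennreal (1 / (\<eta> * s)) * ennreal (\<Sum>k=m..<N. a k y)" if "y \<in> E \<inter> V m \<inter> ?c" for y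
      proof -
        have "(\<Sum>k<N. a k y) = (\<Sum>k<m. a k y) + (\<Sum>k=m..<N. a k y)"
          using \<open>m < N\<close> by (simp add: lessThan_atLeast0 sum.atLeastLessThan_concat)
        then have "\<eta> * s \<le> (\<Sum>k=m..<N. a k y)"
          using that by (auto simp: E_def V_def algebra_simps)
        then have "1 \<le> 1 / (\<eta> * s) * (\<Sum>k=m..<N. a k y)"
          using s \<eta> by (simp add: field_simps)
        then have "ennreal 1 \<le> ennreal (1 / (\<eta> * s) * (\<Sum>k=m..<N. a k y))" by (rule ennreal_leI)
        also have "\<dots> = ennreal (1 / (\<eta> * s)) * ennreal (\<Sum>k=m..<N. a k y)"
          using s \<eta> a_nonneg by (intro ennreal_mult sum_nonneg) auto
        finally show ?thesis by simp
      qed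
      have "emeasure M (E \<inter> V m \<inter> ?c)
        \<le> emeasure M {y\<in>?c. 1 \<le> ennreal (1 / (\<eta> * s)) * ennreal (\<Sum>k=m..<N. a k y)}"
      proof (rule emeasure_mono)
        have "?c \<inter> {y\<in>space M. 1 \<le> ennreal (1 / (\<eta> * s)) * ennreal (\<Sum>k=m..<N. a k y)} \<in> sets M"
          by measurable
        then show "{y\<in>?c. 1 \<le> ennreal (1 / (\<eta> * s)) * ennreal (\<Sum>k=m..<N. a k y)} \<in> sets M"
          by (simp add: space_M Collect_conj_eq)
      qed (use rest in auto)
      also have "\<dots> \<le> ennreal (1 / (\<eta> * s)) * (\<integral>\<^sup>+y. ennreal (\<Sum>k=m..<N. a k y) * indicator ?c y \<partial>M)"
        by (rule nn_integral_Markov_inequality) auto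
      also have "\<dots> \<le> ennreal (1 / (\<eta> * s)) * (ennreal (A * a m x) * emeasure M ?c)"
        by (intro mult_left_mono carleson \<open>m < N\<close>) auto
      also have "\<dots> \<le> ennreal (1 / 2) * emeasure M ?c"
      proof -
        \<comment> \<open>The threshold \<open>\<eta> / (2 * A) * s\<close> is chosen so that
          Markov's inequality and the Carleson condition together leave at most half of the cell, as
          \<open>half\<close> requires.\<close>
        have "1 / (\<eta> * s) * (A * a m x) \<le> 1 / 2" using am s \<eta> A by (simp add: field_simps)
        then have "ennreal (1 / (\<eta> * s) * (A * a m x)) \<le> ennreal (1 / 2)" by (rule ennreal_leI)
        moreover have "ennreal (1 / (\<eta> * s) * (A * a m x)) = ennreal (1 / (\<eta> * s)) * ennreal (A * a m x)"
          using s \<eta> A a_nonneg[of m x] by (intro ennreal_mult) auto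
        ultimately show ?thesis by (metis mult.assoc mult_right_mono zero_le)
      qed
      finally have "2 * emeasure M (E \<inter> V m \<inter> ?c) \<le> 2 * (ennreal (1 / 2) * emeasure M ?c)"
        by (rule mult_left_mono) auto
      also have "\<dots> = emeasure M ?c"
      proof -
        have "2 * ennreal (1 / 2) = 1" by (subst ennreal_numeral[symmetric], subst ennreal_mult[symmetric]) auto
        then show ?thesis by (simp flip: mult.assoc)
      qed
      finally show ?thesis unfolding Vc by (intro half) auto
    qed simp
  qed (use b in auto)
  have "E \<subseteq> {y. ix 0 y = c \<and> s < (\<Sum>k<N. a k y)}"
  proof -
    have "s \<le> (1 + \<eta>) * s" using s \<eta> by simp
    then show ?thesis unfolding E_def by auto
  qed
  then have "E = (\<Union>m<N. E \<inter> V m)" unfolding V_UN by auto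
  then have "emeasure W E = emeasure W (\<Union>m<N. E \<inter> V m)" by simp
  also have "\<dots> = (\<Sum>m<N. emeasure W (E \<inter> V m))"
    using V_disj by (intro sum_emeasure[symmetric]) (auto simp: sets_W disjoint_family_on_def)
  also have "\<dots> \<le> (\<Sum>m<N. ennreal b * emeasure W (V m))"
    by (intro sum_mono V_bound) auto
  also have "\<dots> = ennreal b * emeasure W (\<Union>m<N. V m)"
    using V_disj by (subst sum_emeasure[symmetric]) (auto simp: sets_W sum_distrib_left)
  finally show ?thesis unfolding V_UN E_def .
qed

text \<open>\<open>good_lambda\<close> is applied on one cell of generation 0 at a time, where
  \<open>W\<close> is finite and the sum is bounded; \<open>nn_integral_le_fibres\<close> then puts
  the cells together.\<close>

lemma sum_le_maximal:
  assumes bounded: "\<And>x. \<exists>B. \<forall>y. ix 0 y = ix 0 x \<longrightarrow> (\<Sum>k<N. a k y) \<le> B"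
    and g [measurable]: "g \<in> borel_measurable M" and g_nonneg: "\<And>y. 0 \<le> g y"
    and ag: "\<And>k y. k < N \<Longrightarrow> a k y \<le> g y" and p: "0 < p"
  shows "(\<integral>\<^sup>+y. ennreal ((\<Sum>k<N. a k y) powr p) \<partial>W)
    \<le> ennreal (good_lambda_const b A p) * (\<integral>\<^sup>+y. ennreal (g y powr p) \<partial>W)"
proof -
  have [measurable]: "\<And>k. a k \<in> borel_measurable W" "g \<in> borel_measurable W" "ix 0 \<in> W \<rightarrow>\<^sub>M count_space UNIV"
    by (simp_all add: measurable_W_iff)
  define \<theta> where "\<theta> = b powr (- 1 / (2 * p))"
  have b_powr: "b powr t < 1" if "0 < t" for t
    using powr_less_mono2[OF that, of b 1] b by simp
  have "1 < inverse (b powr (1 / (2 * p)))"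
    using b_powr[of "1 / (2 * p)"] b p by (intro one_less_inverse) auto
  then have \<theta>: "1 < \<theta>" "\<theta> powr p = b powr (- 1 / 2)"
    unfolding \<theta>_def using p by (simp_all add: powr_powr flip: powr_minus)
  define \<gamma> where "\<gamma> = (\<theta> - 1) / (2 * A)"
  have \<gamma>: "0 < \<gamma>" unfolding \<gamma>_def using \<theta> A by simp
  have "b * \<theta> powr p = b powr (1 / 2)"
    using b powr_add[of b 1 "- 1 / 2"] by (simp add: \<theta>)
  also have "\<dots> < 1" using b_powr by simp
  finally have b\<theta>: "b * \<theta> powr p < 1" .
  have "(\<integral>\<^sup>+y. ennreal ((\<Sum>k<N. a k y) powr p) \<partial>W)
    \<le> (\<integral>\<^sup>+y. ennreal (good_lambda_const b A p) * ennreal (g y powr p) \<partial>W)"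
  proof (rule nn_integral_le_fibres[where i = "ix 0"])
    fix c
    show "(\<integral>\<^sup>+y. ennreal ((\<Sum>k<N. a k y) powr p) * indicator {y \<in> space W. ix 0 y = c} y \<partial>W)
      \<le> (\<integral>\<^sup>+y. ennreal (good_lambda_const b A p) * ennreal (g y powr p) * indicator {y \<in> space W. ix 0 y = c} y \<partial>W)"
    proof (cases "\<exists>x. ix 0 x = c")
      case False
      then show ?thesis by simp
    next
      case True
      then obtain x where x: "ix 0 x = c" by blast
      define V where "V = {y. ix 0 y = c}"
      have V_eq: "V = {y \<in> space W. ix 0 y = c}" by (auto simp: V_def space_W)
      have [measurable]: "V \<in> sets W" unfolding V_eq by measurable
      have V: "V \<inter> space W \<in> sets W" by simp
      obtain B where B: "\<forall>y. ix 0 y = ix 0 x \<longrightarrow> (\<Sum>k<N. a k y) \<le> B" using bounded by blast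
      let ?R = "restrict_space W V"
      have space_R: "space ?R = V" by (simp add: space_restrict_space space_W)
      have emR: "emeasure ?R {y\<in>space ?R. P y} = emeasure W {y. ix 0 y = c \<and> P y}" for P
        unfolding space_R by (subst emeasure_restrict_space) (auto simp: V_def V_eq[symmetric, unfolded V_def] Collect_conj_eq)
      have "(\<integral>\<^sup>+y. ennreal ((\<Sum>k<N. a k y) powr p) \<partial>?R)
         \<le> ennreal (\<theta> powr p * (1 / (1 - \<theta> powr p * b) * (\<theta> powr p * (\<theta> powr p / (\<theta> powr p - 1) * \<gamma> powr - p))))
          * (\<integral>\<^sup>+y. ennreal (g y powr p) \<partial>?R)"
      \<comment> \<open>\<open>max B 1\<close> supplies the strictly positive bound that
        \<open>good_lambda\<close> asks for.\<close>
      proof (rule good_lambda[where B = "max B 1"])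
        show "emeasure ?R (space ?R) < \<infinity>"
          unfolding space_R using cell_finite[of 0 x]
          by (subst emeasure_restrict_space) (auto simp: V_eq[symmetric], auto simp: V_def x)
        show "(\<Sum>k<N. a k y) \<le> max B 1" if "y \<in> space ?R" for y
        proof -
          have "ix 0 y = ix 0 x" using that x unfolding space_R by (simp add: V_def)
          then show ?thesis using B by (simp add: le_max_iff_disj)
        qed
        fix s :: real assume s: "0 < s"
        \<comment> \<open>Either all \<open>a k\<close> with \<open>k < N\<close> stay below
          \<open>\<gamma> * s\<close>, or \<open>g\<close>, which dominates them, exceeds
          it.\<close>
        have "{y. ix 0 y = c \<and> \<theta> * s < (\<Sum>k<N. a k y)}
          \<subseteq> {y. ix 0 y = c \<and> \<theta> * s < (\<Sum>k<N. a k y) \<and> (\<forall>k<N. a k y \<le> \<gamma> * s)} \<union> {y. ix 0 y = c \<and> \<gamma> * s < g y}"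
          using ag by (fastforce simp: not_le intro: less_le_trans)
        moreover have [measurable]: "Measurable.pred W (\<lambda>y. ix 0 y = c)"
          by (rule pred_eq_const1[where N = "count_space UNIV"]) auto
        have "{y\<in>space W. ix 0 y = c \<and> \<theta> * s < (\<Sum>k<N. a k y) \<and> (\<forall>k<N. a k y \<le> \<gamma> * s)} \<in> sets W"
          "{y\<in>space W. ix 0 y = c \<and> \<gamma> * s < g y} \<in> sets W" by measurable
        ultimately have "emeasure W {y. ix 0 y = c \<and> \<theta> * s < (\<Sum>k<N. a k y)}
          \<le> emeasure W {y. ix 0 y = c \<and> \<theta> * s < (\<Sum>k<N. a k y) \<and> (\<forall>k<N. a k y \<le> \<gamma> * s)}
            + emeasure W {y. ix 0 y = c \<and> \<gamma> * s < g y}"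
          by (intro order_trans[OF emeasure_mono emeasure_subadditive]) (auto simp: space_W)
        also have "\<dots> \<le> ennreal b * emeasure W {y. ix 0 y = c \<and> s < (\<Sum>k<N. a k y)}
            + emeasure W {y. ix 0 y = c \<and> \<gamma> * s < g y}"
          using sum_good_lambda[OF s, of "\<theta> - 1" c] \<theta> by (intro add_mono) (auto simp: \<gamma>_def)
        finally show "emeasure ?R {y \<in> space ?R. \<theta> * s < (\<Sum>k<N. a k y)}
          \<le> ennreal b * emeasure ?R {y \<in> space ?R. s < (\<Sum>k<N. a k y)}
            + emeasure ?R {y \<in> space ?R. \<gamma> * s < g y}"
          unfolding emR .
      qed (use p \<theta> \<gamma> b b\<theta> g_nonneg a_nonneg in \<open>auto intro!: sum_nonneg measurable_restrict_space1\<close>)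
      also have "\<theta> powr p * (1 / (1 - \<theta> powr p * b) * (\<theta> powr p * (\<theta> powr p / (\<theta> powr p - 1) * \<gamma> powr - p)))
          = good_lambda_const b A p"
        unfolding good_lambda_const_def Let_def \<gamma>_def \<theta>_def[symmetric] \<theta>(2) ..
      finally show ?thesis
        by (simp add: nn_integral_restrict_space[OF V] V_eq[symmetric] nn_integral_cmult mult.assoc)
    qed
  qed auto
  then show ?thesis by (simp add: nn_integral_cmult)
qed

end

end

section \<open>Cubes and the local \<open>A\<^sub>\<infinity>\<close> condition\<close>

lemma mem_cube_iff: "y \<in> cube x r \<longleftrightarrow> (\<forall>i. \<bar>y $ i - x $ i\<bar> < r)"
proof -
  have "y \<in> cube x r \<longleftrightarrow> (\<forall>b\<in>Basis. \<bar>(y - x) \<bullet> b\<bar> < r)"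
    unfolding cube_def infnorm_Max by (subst mem_Collect_eq, subst Max_less_iff) auto
  also have "\<dots> \<longleftrightarrow> (\<forall>i. \<bar>y $ i - x $ i\<bar> < r)"
    by (auto simp: Basis_vec_def inner_axis)
  finally show ?thesis .
qed

lemma cube_eq_box: "cube x r = box (\<chi> i. x $ i - r) (\<chi> i. x $ i + r)"
  by (auto simp: mem_cube_iff mem_box_cart abs_less_iff algebra_simps)

lemma open_cube: "open (cube x r)"
  by (simp add: cube_eq_box open_box)

lemma sets_cube [measurable]: "cube x r \<in> sets borel"
  by (simp add: open_cube borel_open)

lemma emeasure_cbox_const:
  assumes "0 \<le> s" "\<And>i. v $ i - u $ i = s"
  shows "emeasure lborel (cbox (u :: real ^ 'n) v) = ennreal (s ^ CARD('n))"
proof -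
  have le: "u \<bullet> b \<le> v \<bullet> b" and eq: "(v - u) \<bullet> b = s" if "b \<in> Basis" for b
    using that assms by (auto simp: Basis_vec_def inner_axis) (metis diff_ge_0_iff_ge)
  have "emeasure lborel (cbox u v) = ennreal (\<Prod>b\<in>Basis. (v - u) \<bullet> b)"
    using le by (rule emeasure_lborel_cbox)
  also have "(\<Prod>b\<in>Basis. (v - u) \<bullet> b) = s ^ CARD('n)" using eq by simp
  finally show ?thesis .
qed

lemma emeasure_box_eq_cbox: "emeasure lborel (box u v) = emeasure lborel (cbox u v)"
  by (simp add: emeasure_lborel_box_eq emeasure_lborel_cbox_eq)

lemma emeasure_cube: "0 \<le> r \<Longrightarrow> emeasure lborel (cube (x :: real ^ 'n) r) = ennreal ((2 * r) ^ CARD('n))"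
  unfolding cube_eq_box emeasure_box_eq_cbox by (intro emeasure_cbox_const) auto

lemma emeasure_density_eq_set_integral:
  assumes "set_integrable M S f" "\<And>x. 0 \<le> f x" "f \<in> borel_measurable M" "S \<in> sets M"
  shows "emeasure (density M (\<lambda>x. ennreal (f x))) S = ennreal (LINT x:S|M. f x)"
proof -
  have "emeasure (density M (\<lambda>x. ennreal (f x))) S = (\<integral>\<^sup>+x. ennreal (indicator S x *\<^sub>R f x) \<partial>M)"
    using assms by (subst emeasure_density) (auto intro!: nn_integral_cong simp: indicator_def)
  also have "\<dots> = ennreal (LINT x:S|M. f x)"
    using assms unfolding set_integrable_def set_lebesgue_integral_def by (intro nn_integral_eq_integral) auto
  finally show ?thesis .
qed

section \<open>Consequences of the weight and A_infinity conditions\<close>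

lemma weight_measurable:
  assumes "weight \<omega>"
  shows "\<omega> \<in> borel_measurable lebesgue"
proof (rule borel_measurable_LIMSEQ_metric)
  show "(\<lambda>x. indicator (cball 0 (real n)) x *\<^sub>R \<omega> x) \<in> borel_measurable lebesgue" for n
  proof (rule borel_measurable_integrable)
    show "integrable lebesgue (\<lambda>x. indicator (cball 0 (real n)) x *\<^sub>R \<omega> x)"
      using assms unfolding weight_def set_integrable_def[symmetric] by auto
  qed
  show "(\<lambda>n. indicator (cball 0 (real n)) x *\<^sub>R \<omega> x) \<longlonglongrightarrow> \<omega> x" for x
  proof (rule tendsto_eventually)
    show "eventually (\<lambda>n. indicator (cball 0 (real n)) x *\<^sub>R \<omega> x = \<omega> x) sequentially"
      using eventually_ge_at_top[of "nat \<lceil>norm x\<rceil>"] by eventually_elim (auto simp: indicator_def)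
  qed
qed

text \<open>The fraction produced by \<open>Ainf_loc_half\<close>, with
  \<open>K = enn2real t + 1\<close>. Adding 1 gives \<open>K \<ge> 1\<close>, so the value lies
  strictly between 0 and 1 for every \<open>t\<close>, also for \<open>t = \<infinity>\<close>,
  where \<open>enn2real\<close> is 0.\<close>

definition Ainf_ratio :: "ennreal \<Rightarrow> real" where
  "Ainf_ratio t = 1 - exp (- (2 * (enn2real t + 1) + 1)) / (enn2real t + 1)"

lemma Ainf_ratio_bounds: "0 < Ainf_ratio t" "Ainf_ratio t < 1"
proof -
  define K where "K = enn2real t + 1"
  have K: "1 \<le> K" by (simp add: K_def)
  then have "exp (- (2 * K + 1)) < 1" by simp
  with K have "exp (- (2 * K + 1)) < K" by linarith
  with K show "0 < Ainf_ratio t" "Ainf_ratio t < 1"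
    unfolding Ainf_ratio_def K_def[symmetric] by (auto simp: divide_less_eq)
qed

text \<open>
  With \<open>L\<close> the average of \<open>log (1 / \<omega>)\<close>, the function \<open>v = exp L * \<omega>\<close> has mean at most \<open>K\<close> and
  \<open>log v\<close> has mean 0. The tangent line bound \<open>v \<ge> exp (- s) * (1 + s + log v)\<close> with \<open>s = 2 * K + 1\<close>
  is integrated over the complement of \<open>E\<close>, where \<open>\<integral> log v\<close> is minus the integral over \<open>E\<close>.
\<close>

lemma Ainf_loc_half:
  fixes \<omega> :: "real ^ 'n \<Rightarrow> real"
  assumes \<omega>: "\<omega> \<in> Ainf_loc \<rho>" and r: "0 < r" "2 * r \<le> \<rho>"
    and E: "E \<in> sets lebesgue" "E \<subseteq> cube x r"
    and half: "2 * emeasure lebesgue E \<le> emeasure lebesgue (cube x r)"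
  shows "emeasure (density lebesgue (\<lambda>y. ennreal (\<omega> y))) E
    \<le> ennreal (Ainf_ratio (Ainf_loc_const \<rho> \<omega>)) * emeasure (density lebesgue (\<lambda>y. ennreal (\<omega> y))) (cube x r)"
proof -
  define Q where "Q = cube x r"
  define S where "S = Q - E"
  define K where "K = enn2real (Ainf_loc_const \<rho> \<omega>) + 1"
  define g where "g y = ln (inverse (\<omega> y))" for y
  define L where "L = average Q g"
  define V where "V = measure lebesgue Q"
  define s where "s = 2 * K + 1"
  have w: "weight \<omega>" and fin: "Ainf_loc_const \<rho> \<omega> < \<infinity>" using \<omega> by (auto simp: Ainf_loc_def)
  have \<omega>0: "0 \<le> \<omega> y" for y using w by (simp add: weight_def)
  have \<omega>_pos: "AE y in lebesgue. 0 < \<omega> y" using w by (simp add: weight_def)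
  have [measurable]: "\<omega> \<in> borel_measurable lebesgue" using w by (rule weight_measurable)
  have K: "1 \<le> K" unfolding K_def by simp
  have Qs [measurable]: "Q \<in> sets lebesgue" unfolding Q_def by (simp add: open_cube)
  have [measurable]: "E \<in> sets lebesgue" "S \<in> sets lebesgue" using E by (auto simp: S_def)
  have eQ: "emeasure lebesgue Q = ennreal ((2 * r) ^ CARD('n))"
    unfolding Q_def using r by (simp add: emeasure_cube)
  then have eQV: "emeasure lebesgue Q = ennreal V" unfolding V_def by (simp add: measure_def)
  have V: "0 < V" using eQ r by (simp add: V_def measure_def)
  have Q_sub: "Q \<subseteq> cbox (\<chi> i. x $ i - r) (\<chi> i. x $ i + r)"
    unfolding Q_def cube_eq_box by (rule box_subset_cbox)
  have int_\<omega>: "set_integrable lebesgue Q \<omega>"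
    using w Q_sub Qs unfolding weight_def by (meson compact_cbox set_integrable_subset)
  have Q_in: "Q \<in> cubes_upto \<rho>" unfolding cubes_upto_def Q_def using r by auto
  have bound: "(if g absolutely_integrable_on Q
      then ennreal (average Q \<omega> * exp (average Q g)) else \<infinity>) \<le> Ainf_loc_const \<rho> \<omega>"
    unfolding Ainf_loc_const_def g_def using Q_in by (rule SUP_upper)
  \<comment> \<open>Without integrability the supremum defining the constant would be
    \<open>\<infinity>\<close>, which \<open>fin\<close> excludes.\<close>
  have int_g: "set_integrable lebesgue Q g"
    using bound fin by (auto split: if_splits simp: top_unique)
  then have "ennreal (average Q \<omega> * exp L) \<le> Ainf_loc_const \<rho> \<omega>"
    using bound by (simp add: L_def)
  also have "Ainf_loc_const \<rho> \<omega> = ennreal (enn2real (Ainf_loc_const \<rho> \<omega>))"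
    using fin by simp
  finally have "average Q \<omega> * exp L \<le> enn2real (Ainf_loc_const \<rho> \<omega>)"
    by (subst (asm) ennreal_le_iff) auto
  then have "average Q \<omega> * exp L \<le> K" unfolding K_def by simp
  then have \<omega>Q: "exp L * (LINT y:Q|lebesgue. \<omega> y) \<le> K * V"
    using V by (simp add: average_def V_def[symmetric] field_simps)
  have gQ: "(LINT y:Q|lebesgue. g y) = L * V"
    using V by (simp add: L_def average_def V_def[symmetric])
  have fin_sub: "emeasure lebesgue A < \<infinity>" if "A \<in> sets lebesgue" "A \<subseteq> Q" for A
    using emeasure_mono[OF that(2) Qs] unfolding eQV by (rule le_less_trans) simp
  have sub: "E \<subseteq> Q" "S \<subseteq> Q" and disj: "E \<inter> S = {}" "E \<union> S = Q"
    using E by (auto simp: S_def Q_def)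
  have const_int: "set_integrable lebesgue A (\<lambda>y. c)" if "A \<in> sets lebesgue" "A \<subseteq> Q" for A and c :: real
    using fin_sub[OF that] that unfolding set_integrable_def by (intro integrable_indicator) auto
  have const_eq: "(LINT y:A|lebesgue. c) = c * measure lebesgue A" if "A \<in> sets lebesgue" "A \<subseteq> Q" for A and c :: real
    using fin_sub[OF that] that by (subst set_integral_const) (auto simp: mult.commute)
  have int_sub: "set_integrable lebesgue A \<omega>" "set_integrable lebesgue A g" if "A \<in> sets lebesgue" "A \<subseteq> Q" for A
    using set_integrable_subset[OF int_\<omega> that] set_integrable_subset[OF int_g that] .
  have split: "(LINT y:Q|lebesgue. f y) = (LINT y:E|lebesgue. f y) + (LINT y:S|lebesgue. f y)"
    if "set_integrable lebesgue Q f" for f :: "real ^ 'n \<Rightarrow> real"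
    using disj that sub set_integral_Un[of E S lebesgue f]
    by (metis set_integrable_subset \<open>E \<in> sets lebesgue\<close> \<open>S \<in> sets lebesgue\<close>)
  have nonneg: "0 \<le> (LINT y:A|lebesgue. \<omega> y)" for A
    unfolding set_lebesgue_integral_def using \<omega>0 by (intro integral_nonneg_AE) (auto simp: indicator_def)
  have "2 * measure lebesgue E \<le> V"
  proof -
    have "ennreal (2 * measure lebesgue E) \<le> ennreal V"
      using half fin_sub[OF \<open>E \<in> sets lebesgue\<close> sub(1)] unfolding Q_def[symmetric] eQV
      by (subst (asm) emeasure_eq_ennreal_measure) (auto simp: ennreal_mult)
    then show ?thesis using V by (subst (asm) ennreal_le_iff) auto
  qed
  moreover have V_split: "V = measure lebesgue E + measure lebesgue S"
    using split[OF const_int[of Q 1]] by (simp add: const_eq sub V_def)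
  ultimately have S_half: "V / 2 \<le> measure lebesgue S" by simp
  \<comment> \<open>Here \<open>L - g y\<close> is \<open>log v\<close> almost everywhere;
    \<open>t \<le> exp t\<close> bounds its integral over \<open>E\<close> by the integral of
    \<open>v\<close> over \<open>Q\<close>.\<close>
  have E_upper: "L * measure lebesgue E - (LINT y:E|lebesgue. g y) \<le> K * V"
  proof -
    have "L * measure lebesgue E - (LINT y:E|lebesgue. g y) = (LINT y:E|lebesgue. L - g y)"
      by (subst set_integral_diff) (auto simp: const_int const_eq int_sub sub)
    also have "\<dots> \<le> (LINT y:E|lebesgue. exp L * \<omega> y)"
    proof (rule set_integral_mono_AE)
      show "AE y \<in> E in lebesgue. L - g y \<le> exp L * \<omega> y"
        using \<omega>_pos
      proof eventually_elim
        case (elim y)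
        have "L - g y \<le> exp (L - g y)" using exp_ge_add_one_self[of "L - g y"] by linarith
        also have "\<dots> = exp L * \<omega> y" using elim by (simp add: exp_diff g_def field_simps)
        finally show ?case by simp
      qed
    qed (auto simp: const_int int_sub sub intro!: set_integral_diff)
    also have "\<dots> = exp L * (LINT y:E|lebesgue. \<omega> y)" by simp
    also have "\<dots> \<le> exp L * (LINT y:Q|lebesgue. \<omega> y)"
      using split[OF int_\<omega>] nonneg[of S] by (intro mult_left_mono) auto
    finally show ?thesis using \<omega>Q by linarith
  qed
  have "exp (- s) * V \<le> exp (- s) * ((1 + s) * measure lebesgue S + (L * measure lebesgue S - (LINT y:S|lebesgue. g y)))"
  proof (intro mult_left_mono)
    have "L * measure lebesgue S - (LINT y:S|lebesgue. g y) = - (L * measure lebesgue E - (LINT y:E|lebesgue. g y))"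
      using split[OF int_g] gQ V_split by (simp add: algebra_simps)
    \<comment> \<open>With \<open>s = 2 * K + 1\<close> the left side equals
      \<open>(K + 1) * V\<close>. The integral over \<open>E\<close> costs at most
      \<open>K * V\<close>, which leaves \<open>V\<close>.\<close>
    moreover have "(1 + s) * (V / 2) \<le> (1 + s) * measure lebesgue S"
      using S_half K by (intro mult_left_mono) (auto simp: s_def)
    ultimately show "V \<le> (1 + s) * measure lebesgue S + (L * measure lebesgue S - (LINT y:S|lebesgue. g y))"
      using E_upper by (simp add: s_def algebra_simps)
  qed simp
  also have "\<dots> = (LINT y:S|lebesgue. exp (- s) * ((1 + s + L) - g y))"
    by (subst set_integral_mult_right, subst set_integral_diff)
      (auto simp: const_int const_eq int_sub sub algebra_simps)
  also have "\<dots> \<le> (LINT y:S|lebesgue. exp L * \<omega> y)"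
  proof (rule set_integral_mono_AE)
    show "AE y \<in> S in lebesgue. exp (- s) * ((1 + s + L) - g y) \<le> exp L * \<omega> y"
      using \<omega>_pos
    proof eventually_elim
      case (elim y)
      have "exp (- s) * ((1 + s + L) - g y) \<le> exp (- s) * exp (s + L - g y)"
        using exp_ge_add_one_self[of "s + L - g y"] by (intro mult_left_mono) (linarith, simp)
      also have "\<dots> = exp L * \<omega> y" using elim by (simp add: g_def exp_diff exp_add exp_minus field_simps)
      finally show ?case by simp
    qed
  qed (auto simp: const_int int_sub sub intro!: set_integral_diff)
  finally have SV: "exp (- s) * V \<le> exp L * (LINT y:S|lebesgue. \<omega> y)" by simp
  \<comment> \<open>Eliminating \<open>V\<close> between \<open>SV\<close> and
    \<open>\<omega>Q\<close> bounds the weight of \<open>S\<close> below by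
    \<open>exp (- s) / K\<close> times that of \<open>Q\<close>; at most the remaining fraction is
    left for \<open>E\<close>.\<close>
  have "exp L * (exp (- s) * (LINT y:Q|lebesgue. \<omega> y)) \<le> exp L * (K * (LINT y:S|lebesgue. \<omega> y))"
  proof -
    have "exp L * (exp (- s) * (LINT y:Q|lebesgue. \<omega> y)) = exp (- s) * (exp L * (LINT y:Q|lebesgue. \<omega> y))" by simp
    also have "\<dots> \<le> exp (- s) * (K * V)" by (intro mult_left_mono \<omega>Q) simp
    also have "\<dots> = K * (exp (- s) * V)" by simp
    also have "\<dots> \<le> K * (exp L * (LINT y:S|lebesgue. \<omega> y))" using K by (intro mult_left_mono SV) simp
    finally show ?thesis by (simp add: mult_ac)
  qed
  then have "exp (- s) / K * (LINT y:Q|lebesgue. \<omega> y) \<le> (LINT y:S|lebesgue. \<omega> y)"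
    using K by (simp add: field_simps)
  then have final: "(LINT y:E|lebesgue. \<omega> y) \<le> Ainf_ratio (Ainf_loc_const \<rho> \<omega>) * (LINT y:Q|lebesgue. \<omega> y)"
    using split[OF int_\<omega>] unfolding Ainf_ratio_def K_def[symmetric] s_def[symmetric] by (simp add: algebra_simps)
  show ?thesis
    unfolding Q_def[symmetric]
    using final nonneg[of Q] Ainf_ratio_bounds[of "Ainf_loc_const \<rho> \<omega>"]
    by (subst (1 2) emeasure_density_eq_set_integral) (auto simp: int_sub sub \<omega>0 simp flip: ennreal_mult)
qed

section \<open>Grids\<close>

definition grid_index :: "real \<Rightarrow> real ^ 'n \<Rightarrow> int ^ 'n" where
  "grid_index l x = (\<chi> i. \<lfloor>x $ i / l\<rfloor>)"

text \<open>For \<open>l > 0\<close>, the block of \<open>3 ^ CARD('n)\<close> grid cells around the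
  cell of \<open>x\<close>. It replaces a cube centred at \<open>x\<close> and, unlike one, depends
  only on the cell of \<open>x\<close>.\<close>

definition grid_nbhd :: "real \<Rightarrow> real ^ 'n \<Rightarrow> (real ^ 'n) set" where
  "grid_nbhd l x = {y. \<forall>i. \<bar>\<lfloor>y $ i / l\<rfloor> - \<lfloor>x $ i / l\<rfloor>\<bar> \<le> 1}"

lemma grid_index_eq_iff: "grid_index l x = grid_index l y \<longleftrightarrow> (\<forall>i. \<lfloor>x $ i / l\<rfloor> = \<lfloor>y $ i / l\<rfloor>)"
  by (simp add: grid_index_def vec_eq_iff)

lemma grid_nbhd_cong: "grid_index l x = grid_index l y \<Longrightarrow> grid_nbhd l x = grid_nbhd l y"
  by (simp add: grid_nbhd_def grid_index_eq_iff)

lemma grid_nbhd_sym: "y \<in> grid_nbhd l x \<longleftrightarrow> x \<in> grid_nbhd l y"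
  by (simp add: grid_nbhd_def abs_minus_commute)

lemma grid_nbhd_refl: "x \<in> grid_nbhd l x"
  by (simp add: grid_nbhd_def)

text \<open>Source of the nesting: doubling the side acts on indices as integer division by 2, so
  the index at side \<open>l\<close> determines the one at side \<open>2 * l\<close>.\<close>

lemma floor_double: "\<lfloor>t / (2 * l)\<rfloor> = \<lfloor>t / l\<rfloor> div 2" for t l :: real
  using floor_divide_real_eq_div[of 2 "t / l"] by (simp add: mult.commute)

lemma grid_index_double: "grid_index l x = grid_index l y \<Longrightarrow> grid_index (2 * l) x = grid_index (2 * l) y"
  by (simp add: grid_index_eq_iff floor_double)

lemma grid_nbhd_double: "grid_nbhd l x \<subseteq> grid_nbhd (2 * l) x"
proof
  fix y assume y: "y \<in> grid_nbhd l x"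
  have "\<bar>u div 2 - v div 2\<bar> \<le> 1" if "\<bar>u - v\<bar> \<le> 1" for u v :: int
    using that by linarith
  then show "y \<in> grid_nbhd (2 * l) x"
    using y unfolding grid_nbhd_def floor_double by blast
qed

lemma cube_subset_grid_nbhd:
  assumes "0 < l" shows "cube x l \<subseteq> grid_nbhd l x"
proof
  fix y assume y: "y \<in> cube x l"
  have "\<bar>\<lfloor>y $ i / l\<rfloor> - \<lfloor>x $ i / l\<rfloor>\<bar> \<le> 1" for i
  proof -
    have "\<bar>y $ i - x $ i\<bar> < l" using y by (simp add: mem_cube_iff)
    then have "\<bar>y $ i / l - x $ i / l\<bar> < 1"
      using assms by (simp add: diff_divide_distrib[symmetric])
    then show ?thesis by linarith
  qed
  then show "y \<in> grid_nbhd l x" by (simp add: grid_nbhd_def)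
qed

text \<open>Numbers whose floors are at most 1 apart are less than 2 apart. For
  \<open>l = mesh \<rho> k\<close> the radius \<open>2 * l\<close> stays within
  \<open>\<rho>\<close>.\<close>

lemma grid_nbhd_subset_cube:
  assumes "0 < l" shows "grid_nbhd l x \<subseteq> cube x (2 * l)"
proof
  fix y assume y: "y \<in> grid_nbhd l x"
  have "\<bar>y $ i - x $ i\<bar> < 2 * l" for i
  proof -
    have "\<bar>\<lfloor>y $ i / l\<rfloor> - \<lfloor>x $ i / l\<rfloor>\<bar> \<le> 1" using y by (simp add: grid_nbhd_def)
    then have "\<bar>y $ i / l - x $ i / l\<bar> < 2" by linarith
    then have "\<bar>y $ i - x $ i\<bar> / l < 2"
      using assms by (simp add: diff_divide_distrib[symmetric])
    then show ?thesis using assms by (simp add: field_simps)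
  qed
  then show "y \<in> cube x (2 * l)" by (simp add: mem_cube_iff)
qed

section \<open>Measurability of the grid\<close>

lemma borel_measurable_floor_component [measurable]:
  "(\<lambda>x :: real ^ 'n. \<lfloor>x $ i / l\<rfloor>) \<in> borel \<rightarrow>\<^sub>M count_space UNIV"
  by measurable

lemma grid_index_measurable [measurable]: "grid_index l \<in> (borel :: (real ^ 'n) measure) \<rightarrow>\<^sub>M count_space UNIV"
proof (rule measurable_count_space_eq2_countable[THEN iffD2], intro conjI ballI)
  fix c :: "int ^ 'n"
  have "{x \<in> space borel. \<forall>i. \<lfloor>x $ i / l\<rfloor> = c $ i} \<in> sets (borel :: (real ^ 'n) measure)"
    by measurable
  then show "grid_index l -` {c} \<inter> space borel \<in> sets borel"
    by (simp add: grid_index_def vimage_def vec_eq_iff)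
qed auto

text \<open>Joint measurability in both points is required for exchanging the integrals in
  \<open>nn_integral_grid_nbhd_le\<close>. The floors are cast to reals so that they are compared as
  Borel functions.\<close>

lemma grid_nbhd_pred_measurable:
  "Measurable.pred (borel \<Otimes>\<^sub>M borel) (\<lambda>(x :: real ^ 'n, y). y \<in> grid_nbhd l x)"
proof -
  have "Measurable.pred (borel \<Otimes>\<^sub>M borel) (\<lambda>z :: (real ^ 'n) \<times> (real ^ 'n).
      \<forall>i. \<bar>real_of_int \<lfloor>snd z $ i / l\<rfloor> - real_of_int \<lfloor>fst z $ i / l\<rfloor>\<bar> \<le> 1)"
    by measurable
  moreover have "\<bar>real_of_int u - real_of_int v\<bar> \<le> 1 \<longleftrightarrow> \<bar>u - v\<bar> \<le> 1" for u v
    by linarith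
  ultimately show ?thesis by (simp add: grid_nbhd_def case_prod_unfold)
qed

lemma sets_grid_nbhd [measurable]: "grid_nbhd l (x :: real ^ 'n) \<in> sets borel"
proof -
  have "Measurable.pred borel (\<lambda>y. case (x, y) of (x, y) \<Rightarrow> y \<in> grid_nbhd l x)"
    by (rule measurable_compose[OF _ grid_nbhd_pred_measurable]) simp
  then show ?thesis by (simp add: pred_def)
qed

lemma sets_grid_cell [measurable]: "{y. grid_index l y = grid_index l (x :: real ^ 'n)} \<in> sets borel"
  using measurable_sets[OF grid_index_measurable, of "{grid_index l x}" l] by (simp add: vimage_def)

text \<open>The A_infinity condition speaks of open cubes, the grid of half-open cells. With
  \<open>z\<close> the centre of the cell, the two differ only within the boundary of a box, a null
  set.\<close>

lemma grid_cell_sandwich: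
  fixes x :: "real ^ 'n"
  assumes "0 < l"
  obtains z where "cube z (l / 2) \<subseteq> {y. grid_index l y = grid_index l x}"
    "{y. grid_index l y = grid_index l x} - cube z (l / 2) \<in> null_sets lborel"
proof
  define z where "z = (\<chi> i. (of_int \<lfloor>x $ i / l\<rfloor> + 1 / 2) * l)"
  let ?u = "\<chi> i. z $ i - l / 2" and ?v = "\<chi> i. z $ i + l / 2"
  have cell: "y \<in> {y. grid_index l y = grid_index l x} \<longleftrightarrow>
      (\<forall>i. z $ i - l / 2 \<le> y $ i \<and> y $ i < z $ i + l / 2)" for y
  proof -
    have "\<lfloor>y $ i / l\<rfloor> = \<lfloor>x $ i / l\<rfloor> \<longleftrightarrow> z $ i - l / 2 \<le> y $ i \<and> y $ i < z $ i + l / 2" for i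
    proof -
      have "z $ i - l / 2 = of_int \<lfloor>x $ i / l\<rfloor> * l" "z $ i + l / 2 = (of_int \<lfloor>x $ i / l\<rfloor> + 1) * l"
        by (simp_all add: z_def algebra_simps)
      then show ?thesis
        using assms by (simp only: floor_eq_iff pos_le_divide_eq pos_divide_less_eq)
    qed
    then show ?thesis by (simp add: grid_index_eq_iff)
  qed
  show sub: "cube z (l / 2) \<subseteq> {y. grid_index l y = grid_index l x}"
    unfolding cube_eq_box by (intro subsetI, subst cell) (auto simp: mem_box_cart less_imp_le)
  have "{y. grid_index l y = grid_index l x} \<subseteq> cbox ?u ?v"
    by (intro subsetI, subst (asm) cell) (auto simp: mem_box_cart less_imp_le)
  moreover have "cbox ?u ?v - box ?u ?v \<in> null_sets lborel"
  proof (rule null_setsI)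
    show "emeasure lborel (cbox ?u ?v - box ?u ?v) = 0"
      using emeasure_lborel_cbox_finite[of ?u ?v]
      by (subst emeasure_Diff) (simp_all add: emeasure_box_eq_cbox box_subset_cbox less_top)
  qed simp
  ultimately show "{y. grid_index l y = grid_index l x} - cube z (l / 2) \<in> null_sets lborel"
    unfolding cube_eq_box by (elim null_sets_subset) auto
qed

lemma emeasure_grid_cell:
  fixes x :: "real ^ 'n"
  assumes "0 < l"
  shows "emeasure lborel {y. grid_index l y = grid_index l x} = ennreal (l ^ CARD('n))"
proof -
  obtain z where z: "cube z (l / 2) \<subseteq> {y. grid_index l y = grid_index l x}"
    "{y. grid_index l y = grid_index l x} - cube z (l / 2) \<in> null_sets lborel"
    using grid_cell_sandwich[OF assms] by blast
  have "emeasure lborel {y. grid_index l y = grid_index l x}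
    = emeasure lborel (cube z (l / 2) \<union> ({y. grid_index l y = grid_index l x} - cube z (l / 2)))"
    using z(1) by (simp add: Un_absorb1)
  also have "\<dots> = emeasure lborel (cube z (l / 2))"
    using z(2) by (intro emeasure_Un_null_set) auto
  finally show ?thesis using assms by (simp add: emeasure_cube)
qed

text \<open>The part of \<open>E\<close> on the cell boundary is null for the weighted measure too.
  Discarding it reduces the claim to \<open>Ainf_loc_half\<close> on the open cube of side
  \<open>l\<close>, whose Lebesgue measure equals that of the cell.\<close>

lemma Ainf_loc_half_grid:
  fixes \<omega> :: "real ^ 'n \<Rightarrow> real"
  assumes \<omega>: "\<omega> \<in> Ainf_loc \<rho>" and l: "0 < l" "l \<le> \<rho>"
    and E: "E \<in> sets lebesgue" "E \<subseteq> {y. grid_index l y = grid_index l x}"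
    and half: "2 * emeasure lebesgue E \<le> emeasure lebesgue {y. grid_index l y = grid_index l x}"
  shows "emeasure (density lebesgue (\<lambda>y. ennreal (\<omega> y))) E
    \<le> ennreal (Ainf_ratio (Ainf_loc_const \<rho> \<omega>)) *
      emeasure (density lebesgue (\<lambda>y. ennreal (\<omega> y))) {y. grid_index l y = grid_index l x}"
proof -
  let ?W = "density lebesgue (\<lambda>y. ennreal (\<omega> y))" and ?c = "{y. grid_index l y = grid_index l x}"
  have [measurable]: "\<omega> \<in> borel_measurable lebesgue"
    using \<omega> weight_measurable by (auto simp: Ainf_loc_def)
  obtain z where z: "cube z (l / 2) \<subseteq> ?c" "?c - cube z (l / 2) \<in> null_sets lborel"
    using grid_cell_sandwich[OF l(1)] by blast
  have [measurable]: "cube z (l / 2) \<in> sets lebesgue" "?c \<in> sets lebesgue" "E \<in> sets lebesgue"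
    using E by (simp_all add: open_cube)
  have null: "E - cube z (l / 2) \<in> null_sets ?W"
  proof -
    have "E - cube z (l / 2) \<in> null_sets lebesgue"
      using null_sets_completion_subset[OF _ null_sets_completionI[OF z(2)], of "E - cube z (l / 2)"] E by auto
    from AE_not_in[OF this] show ?thesis
      by (subst null_sets_density_iff) (auto elim: eventually_mono)
  qed
  have "emeasure ?W E = emeasure ?W ((E \<inter> cube z (l / 2)) \<union> (E - cube z (l / 2)))"
    by (simp add: Int_Diff_Un)
  also have "\<dots> = emeasure ?W (E \<inter> cube z (l / 2))"
    using null by (intro emeasure_Un_null_set) auto
  also have "\<dots> \<le> ennreal (Ainf_ratio (Ainf_loc_const \<rho> \<omega>)) * emeasure ?W (cube z (l / 2))"
  proof (rule Ainf_loc_half[OF \<omega>])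
    have "2 * emeasure lebesgue (E \<inter> cube z (l / 2)) \<le> 2 * emeasure lebesgue E"
      by (intro mult_left_mono emeasure_mono) auto
    also have "\<dots> \<le> emeasure lebesgue (cube z (l / 2))"
      using half l by (simp add: emeasure_grid_cell emeasure_cube)
    finally show "2 * emeasure lebesgue (E \<inter> cube z (l / 2)) \<le> emeasure lebesgue (cube z (l / 2))" .
  qed (use l in auto)
  also have "\<dots> \<le> ennreal (Ainf_ratio (Ainf_loc_const \<rho> \<omega>)) * emeasure ?W ?c"
    using z(1) by (intro mult_left_mono emeasure_mono) auto
  finally show ?thesis .
qed

text \<open>By Fubini, a point \<open>z\<close> is counted by the \<open>y\<close> in
  \<open>H\<close> with \<open>z\<close> in \<open>grid_nbhd l y\<close>. By symmetry these lie in
  \<open>cube z (2 * l)\<close>, of volume \<open>(4 * l) ^ CARD('n)\<close>, and \<open>sub\<close>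
  puts \<open>z\<close> into \<open>T\<close>.\<close>

lemma nn_integral_grid_nbhd_le:
  fixes \<mu> :: "(real ^ 'n) measure"
  assumes \<mu>: "sigma_finite_measure \<mu>" "sets \<mu> = sets borel" and l: "0 < l"
    and H: "H \<in> sets borel" "T \<in> sets borel" and sub: "\<And>y. y \<in> H \<Longrightarrow> grid_nbhd l y \<subseteq> T"
  shows "(\<integral>\<^sup>+y. emeasure \<mu> (grid_nbhd l y) * indicator H y \<partial>lborel)
    \<le> ennreal ((4 * l) ^ CARD('n)) * emeasure \<mu> T"
proof -
  interpret \<mu>: sigma_finite_measure \<mu> by fact
  interpret P: pair_sigma_finite lborel \<mu> ..
  have [measurable]: "H \<in> sets borel" "T \<in> sets borel" "T \<in> sets \<mu>" using H \<mu> by auto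
  have [measurable_cong]: "sets \<mu> = sets borel" by fact
  have [measurable]: "Measurable.pred (lborel \<Otimes>\<^sub>M \<mu>) (\<lambda>(x, y). y \<in> grid_nbhd l x)"
  proof -
    have "sets (lborel \<Otimes>\<^sub>M \<mu>) = sets (borel \<Otimes>\<^sub>M borel)"
      by (rule sets_pair_measure_cong) (simp_all add: \<mu>)
    then show ?thesis
      using grid_nbhd_pred_measurable[of l] by (subst measurable_cong_sets[OF _ refl])
  qed
  have "(\<integral>\<^sup>+y. emeasure \<mu> (grid_nbhd l y) * indicator H y \<partial>lborel)
    = (\<integral>\<^sup>+y. (\<integral>\<^sup>+z. indicator (grid_nbhd l y) z * indicator H y \<partial>\<mu>) \<partial>lborel)"
    by (intro nn_integral_cong) (simp add: nn_integral_multc \<mu>(2))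
  also have "\<dots> = (\<integral>\<^sup>+z. (\<integral>\<^sup>+y. indicator (grid_nbhd l y) z * indicator H y \<partial>lborel) \<partial>\<mu>)"
  proof (rule P.Fubini'[symmetric])
    have "(\<lambda>w. indicator {w \<in> space (lborel \<Otimes>\<^sub>M \<mu>). case w of (y, z) \<Rightarrow> z \<in> grid_nbhd l y} w * indicator H (fst w) :: ennreal)
      \<in> borel_measurable (lborel \<Otimes>\<^sub>M \<mu>)" by measurable
    then show "(\<lambda>(y, z). indicator (grid_nbhd l y) z * indicator H y :: ennreal) \<in> borel_measurable (lborel \<Otimes>\<^sub>M \<mu>)"
      by (rule subst[OF measurable_cong, rotated 1]) (auto simp: indicator_def space_pair_measure)
  qed
  also have "\<dots> \<le> (\<integral>\<^sup>+z. (\<integral>\<^sup>+y. indicator T z * indicator (cube z (2 * l)) y \<partial>lborel) \<partial>\<mu>)"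
  proof (intro nn_integral_mono)
    show "indicator (grid_nbhd l y) z * indicator H y \<le> (indicator T z * indicator (cube z (2 * l)) y :: ennreal)" for y z
      using sub[of y] grid_nbhd_subset_cube[OF l, of z] grid_nbhd_sym[of z l y] by (auto simp: indicator_def)
  qed
  also have "\<dots> = (\<integral>\<^sup>+z. ennreal ((4 * l) ^ CARD('n)) * indicator T z \<partial>\<mu>)"
    using l by (intro nn_integral_cong) (simp add: nn_integral_cmult emeasure_cube mult.commute)
  also have "\<dots> = ennreal ((4 * l) ^ CARD('n)) * emeasure \<mu> T"
    by (simp add: nn_integral_cmult)
  finally show ?thesis .
qed

section \<open>Domination of the Riesz potential by a grid sum\<close>

lemma ennpowr_ennreal: "0 \<le> x \<Longrightarrow> ennpowr (ennreal x) p = ennreal (x powr p)"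
  by (simp add: ennpowr_def)

lemma ennpowr_top [simp]: "ennpowr \<infinity> p = \<infinity>" "ennpowr top p = \<infinity>"
  by (simp_all add: ennpowr_def)

lemma ennpowr_mono:
  assumes "a \<le> b" "0 < p" shows "ennpowr a p \<le> ennpowr b p"
proof (cases "b = \<infinity>")
  case False
  then have "a \<noteq> \<infinity>" using assms(1) by (auto simp: top_unique)
  with False assms show ?thesis
    by (auto simp: ennpowr_def less_top[symmetric] intro!: ennreal_leI powr_mono2 enn2real_mono)
qed simp

lemma ennpowr_powr_inverse:
  assumes "p \<noteq> 0" shows "ennpowr (ennpowr t p) (1 / p) = t" "ennpowr (ennpowr t (1 / p)) p = t"
  using assms by (cases t; simp add: ennpowr_ennreal powr_powr)+

text \<open>The inverse power \<open>1 / p\<close> moves the bound from the powers back to the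
  \<open>f i\<close>, so monotonicity does the work of continuity.\<close>

lemma ennpowr_SUP_le:
  assumes "0 < p" shows "ennpowr (SUP i\<in>I. f i) p \<le> (SUP i\<in>I. ennpowr (f i) p)"
proof -
  let ?s = "SUP i\<in>I. ennpowr (f i) p"
  have "f i \<le> ennpowr ?s (1 / p)" if "i \<in> I" for i
  proof -
    have "f i = ennpowr (ennpowr (f i) p) (1 / p)" using assms by (simp add: ennpowr_powr_inverse)
    also have "\<dots> \<le> ennpowr ?s (1 / p)"
      using assms that by (intro ennpowr_mono SUP_upper) auto
    finally show ?thesis .
  qed
  then have "ennpowr (SUP i\<in>I. f i) p \<le> ennpowr (ennpowr ?s (1 / p)) p"
    using assms by (intro ennpowr_mono SUP_least) auto
  then show ?thesis using assms by (simp add: ennpowr_powr_inverse)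
qed

lemma ennpowr_cmult:
  assumes "0 < c" shows "ennpowr (ennreal c * t) p = ennreal (c powr p) * ennpowr t p"
proof (cases t)
  case (real r)
  then show ?thesis using assms by (simp add: ennpowr_ennreal powr_mult flip: ennreal_mult)
next
  case top
  then show ?thesis using assms by (simp add: ennreal_mult_top)
qed

text \<open>The sum is at most twice the maximum, which treats \<open>p < 1\<close> and
  \<open>p \<ge> 1\<close> alike.\<close>

lemma ennpowr_add_le:
  assumes "0 < p" shows "ennpowr (a + b) p \<le> ennreal (2 powr p) * (ennpowr a p + ennpowr b p)"
proof -
  have "a + b \<le> ennreal 2 * max a b"
    by (simp add: mult_2 add_mono)
  then have "ennpowr (a + b) p \<le> ennpowr (ennreal 2 * max a b) p"
    using assms by (rule ennpowr_mono)
  also have "\<dots> = ennreal (2 powr p) * ennpowr (max a b) p" by (rule ennpowr_cmult) simp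
  also have "\<dots> \<le> ennreal (2 powr p) * (ennpowr a p + ennpowr b p)"
    by (intro mult_left_mono) (auto simp: max_def)
  finally show ?thesis .
qed

lemma ennpowr_measurable [measurable]:
  assumes [measurable]: "f \<in> borel_measurable M"
  shows "(\<lambda>x. ennpowr (f x) p) \<in> borel_measurable M"
  unfolding ennpowr_def by measurable

lemma riesz_factor_le_frac_maximal:
  assumes "0 < r" "r \<le> \<rho>"
  shows "ennreal (r powr (\<alpha> - real CARD('n))) * emeasure \<mu> (cube x r) \<le> frac_maximal \<alpha> \<rho> \<mu> (x :: real ^ 'n)"
  unfolding frac_maximal_def using assms
  by (intro SUP_upper2[of r]) auto

text \<open>The function is lower semicontinuous: an open cube is the increasing union of smaller
  concentric cubes, so one of these already has mass above \<open>t\<close>, and it stays inside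
  \<open>cube z r\<close> for \<open>z\<close> near \<open>x\<close>. Continuity from below also
  covers infinite masses.\<close>

lemma emeasure_cube_measurable:
  fixes \<mu> :: "(real ^ 'n) measure"
  assumes \<mu>: "sets \<mu> = sets borel"
  shows "(\<lambda>x. emeasure \<mu> (cube x r)) \<in> borel_measurable borel"
proof (rule borel_measurableI_greater)
  fix t
  have "open {x. t < emeasure \<mu> (cube x r)}"
  proof (rule openI)
    fix x assume "x \<in> {x. t < emeasure \<mu> (cube x r)}"
    then have t: "t < emeasure \<mu> (cube x r)" by simp
    define s where "s m = r - 1 / real (Suc m)" for m
    have Un: "cube x r = (\<Union>m. cube x (s m))"
    proof (intro set_eqI iffI)
      fix y assume "y \<in> cube x r"
      then have "0 < r - infnorm (y - x)" by (simp add: cube_def)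
      then obtain m where "1 / real (Suc m) < r - infnorm (y - x)" by (rule nat_approx_posE)
      then show "y \<in> (\<Union>m. cube x (s m))" by (auto simp: cube_def s_def intro!: exI[of _ m])
    next
      fix y assume "y \<in> (\<Union>m. cube x (s m))"
      then obtain m where "infnorm (y - x) < r - 1 / real (Suc m)" by (auto simp: cube_def s_def)
      then have "infnorm (y - x) < r" by (rule less_le_trans) simp
      then show "y \<in> cube x r" by (simp add: cube_def)
    qed
    have "incseq (\<lambda>m. cube x (s m))"
    proof (rule incseq_SucI)
      fix m
      have "s m \<le> s (Suc m)" unfolding s_def by (simp add: field_simps)
      then show "cube x (s m) \<subseteq> cube x (s (Suc m))" by (auto simp: cube_def)
    qed
    then have "(SUP m. emeasure \<mu> (cube x (s m))) = emeasure \<mu> (cube x r)"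
      unfolding Un by (intro SUP_emeasure_incseq) (auto simp: \<mu>)
    with t obtain m where m: "t < emeasure \<mu> (cube x (s m))"
      by (metis less_SUP_iff)
    have "cube x (1 / real (Suc m)) \<subseteq> {x. t < emeasure \<mu> (cube x r)}"
    proof
      fix z assume z: "z \<in> cube x (1 / real (Suc m))"
      have "cube x (s m) \<subseteq> cube z r"
      proof
        fix y assume y: "y \<in> cube x (s m)"
        have "\<bar>y $ i - z $ i\<bar> < r" for i
        proof -
          have "\<bar>y $ i - x $ i\<bar> < r - 1 / real (Suc m)" "\<bar>z $ i - x $ i\<bar> < 1 / real (Suc m)"
            using y z unfolding mem_cube_iff s_def by blast+
          then show ?thesis by linarith
        qed
        then show "y \<in> cube z r" by (simp add: mem_cube_iff)
      qed
      then have "emeasure \<mu> (cube x (s m)) \<le> emeasure \<mu> (cube z r)"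
        by (intro emeasure_mono) (auto simp: \<mu>)
      with m show "z \<in> {x. t < emeasure \<mu> (cube x r)}" by auto
    qed
    moreover obtain e where "0 < e" "ball x e \<subseteq> cube x (1 / real (Suc m))"
    proof -
      have "x \<in> cube x (1 / real (Suc m))" by (simp add: cube_def infnorm_0)
      then show ?thesis using that open_cube open_contains_ball by metis
    qed
    ultimately show "\<exists>e>0. ball x e \<subseteq> {x. t < emeasure \<mu> (cube x r)}" by blast
  qed
  then show "{x \<in> space borel. t < emeasure \<mu> (cube x r)} \<in> sets borel" by simp
qed

section \<open>Dyadic scales and decomposition of the kernel\<close>

definition mesh :: "real \<Rightarrow> nat \<Rightarrow> real" where
  "mesh \<rho> k = \<rho> / 2 ^ Suc k"

lemma mesh_pos: "0 < \<rho> \<Longrightarrow> 0 < mesh \<rho> k"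
  by (simp add: mesh_def)

lemma mesh_Suc: "mesh \<rho> k = 2 * mesh \<rho> (Suc k)"
  by (simp add: mesh_def)

lemma mesh_le: "0 < \<rho> \<Longrightarrow> 2 * mesh \<rho> k \<le> \<rho>"
  by (simp add: mesh_def divide_le_eq)

lemma grid_index_mesh_mono:
  "m \<le> k \<Longrightarrow> grid_index (mesh \<rho> k) x = grid_index (mesh \<rho> k) y \<Longrightarrow> grid_index (mesh \<rho> m) x = grid_index (mesh \<rho> m) y"
proof (induction k rule: dec_induct)
  case (step k)
  then show ?case using grid_index_double[of "mesh \<rho> (Suc k)" x y] by (simp add: mesh_Suc[of \<rho> k])
qed

lemma grid_nbhd_mesh_mono: "m \<le> k \<Longrightarrow> grid_nbhd (mesh \<rho> k) x \<subseteq> grid_nbhd (mesh \<rho> m) x"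
proof (induction k rule: dec_induct)
  case (step k)
  then show ?case using grid_nbhd_double[of "mesh \<rho> (Suc k)" x] by (simp add: mesh_Suc[of \<rho> k])
qed simp

lemma suminf_ennreal_const_top:
  fixes c :: ennreal assumes "0 < c" shows "(\<Sum>k::nat. c) = \<infinity>"
proof -
  have "(\<Sum>k::nat. c) = (\<integral>\<^sup>+k. c \<partial>count_space (UNIV :: nat set))" by (rule nn_integral_count_space_nat[symmetric])
  also have "\<dots> = \<infinity>" using assms by (simp add: ennreal_mult_top)
  finally show ?thesis .
qed

text \<open>With \<open>d\<close> the distance of the two points and
  \<open>mesh \<rho> (Suc k) < d \<le> mesh \<rho> k\<close>, the term of index \<open>k\<close>
  dominates the kernel up to the factor \<open>2 powr - \<beta>\<close>. Since
  \<open>mesh \<rho> 0 = \<rho> / 2\<close>, the annulus \<open>\<rho> / 2 \<le> d < \<rho>\<close>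
  is left to the separate \<open>cube x \<rho>\<close> term.\<close>

lemma riesz_kernel_le:
  fixes x y :: "real ^ 'n"
  assumes \<alpha>: "\<alpha> < real CARD('n)" and \<rho>: "0 < \<rho>"
  defines "\<beta> \<equiv> \<alpha> - real CARD('n)"
  shows "riesz_kernel \<alpha> \<rho> (x - y) \<le> ennreal (2 powr - \<beta>) * (ennreal (\<rho> powr \<beta>) * indicator (cube x \<rho>) y
    + (\<Sum>k. ennreal (mesh \<rho> k powr \<beta>) * indicator (grid_nbhd (mesh \<rho> k) x) y))"
proof -
  have \<beta>: "\<beta> < 0" using \<alpha> by (simp add: \<beta>_def)
  let ?S = "\<Sum>k. ennreal (mesh \<rho> k powr \<beta>) * indicator (grid_nbhd (mesh \<rho> k) x) y :: ennreal"
  define d where "d = infnorm (x - y)"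
  have half: "d powr \<beta> \<le> 2 powr - \<beta> * r powr \<beta>" if "0 < r" "r / 2 \<le> d" for r
  proof -
    have "d powr \<beta> \<le> (r / 2) powr \<beta>" using that \<beta> by (intro powr_mono2') auto
    also have "\<dots> = 2 powr - \<beta> * r powr \<beta>" using that by (simp add: powr_divide powr_minus field_simps)
    finally show ?thesis .
  qed
  consider "x = y" | "x \<noteq> y" "\<rho> \<le> d" | "x \<noteq> y" "d < \<rho>" "\<rho> / 2 \<le> d" | "x \<noteq> y" "d < \<rho> / 2"
    by linarith
  then show ?thesis
  proof cases
    case 1
    \<comment> \<open>On the diagonal the kernel is infinite, and so is the sum: each neighbourhood
      contains \<open>x\<close>, and \<open>\<beta> < 0\<close> makes each term at least
      \<open>\<rho> powr \<beta>\<close>.\<close>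
    have "\<infinity> = (\<Sum>k::nat. ennreal (\<rho> powr \<beta>))"
      using \<rho> by (simp add: suminf_ennreal_const_top)
    also have "\<dots> \<le> ?S"
    proof (rule suminf_le)
      fix k
      have "\<rho> powr \<beta> \<le> mesh \<rho> k powr \<beta>"
        using mesh_le[OF \<rho>, of k] mesh_pos[OF \<rho>, of k] \<beta> by (intro powr_mono2') auto
      then show "ennreal (\<rho> powr \<beta>) \<le> ennreal (mesh \<rho> k powr \<beta>) * indicator (grid_nbhd (mesh \<rho> k) x) y"
        using 1 by (simp add: grid_nbhd_refl ennreal_leI)
    qed auto
    finally have "?S = \<infinity>" by (simp add: top_unique)
    then show ?thesis by (simp add: ennreal_mult_top)
  next
    case 2
    then show ?thesis by (simp add: riesz_kernel_def d_def)
  next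
    case 3
    then have "y \<in> cube x \<rho>" by (simp add: cube_def d_def infnorm_sub)
    then have "riesz_kernel \<alpha> \<rho> (x - y) \<le> ennreal (2 powr - \<beta>) * (ennreal (\<rho> powr \<beta>) * indicator (cube x \<rho>) y)"
      using half[OF \<rho> 3(3)] 3 by (simp add: riesz_kernel_def d_def[symmetric] \<beta>_def[symmetric] ennreal_leI flip: ennreal_mult)
    also have "\<dots> \<le> ennreal (2 powr - \<beta>) * (ennreal (\<rho> powr \<beta>) * indicator (cube x \<rho>) y + ?S)"
      by (intro mult_left_mono) auto
    finally show ?thesis .
  next
    case 4
    have "0 < d" using 4 unfolding d_def by (simp add: infnorm_pos_lt)
    have "(\<lambda>k. mesh \<rho> k) \<longlonglongrightarrow> 0"
      unfolding mesh_def by (rule LIMSEQ_Suc[OF LIMSEQ_divide_realpow_zero]) simp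
    then have ex: "\<exists>k. mesh \<rho> k < d"
      using order_tendstoD(2)[OF _ \<open>0 < d\<close>] by (metis eventually_sequentially order_refl)
    define j where "j = (LEAST k. mesh \<rho> k < d)"
    have j: "mesh \<rho> j < d" unfolding j_def using ex by (rule LeastI_ex)
    have "j \<noteq> 0" using j 4 by (cases "j = 0") (auto simp: mesh_def)
    then obtain k where k: "j = Suc k" by (cases j) auto
    have le: "d \<le> mesh \<rho> k" using not_less_Least[of k "\<lambda>k. mesh \<rho> k < d"] k unfolding j_def by auto
    have "y \<in> grid_nbhd (mesh \<rho> k) x"
    proof (cases "d = mesh \<rho> k")
      \<comment> \<open>At this endpoint \<open>y\<close> lies outside the open cube of radius
        \<open>mesh \<rho> k\<close>, but the quotients are still at most 1 apart, which suffices
        for their floors.\<close>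
      case True
      have "\<bar>\<lfloor>y $ i / mesh \<rho> k\<rfloor> - \<lfloor>x $ i / mesh \<rho> k\<rfloor>\<bar> \<le> 1" for i
      proof -
        have "\<bar>y $ i - x $ i\<bar> \<le> mesh \<rho> k"
          using component_le_infnorm_cart[of "x - y" i] True by (simp add: d_def abs_minus_commute)
        then have "\<bar>y $ i / mesh \<rho> k - x $ i / mesh \<rho> k\<bar> \<le> 1"
          using mesh_pos[OF \<rho>, of k] by (simp add: diff_divide_distrib[symmetric])
        then show ?thesis by linarith
      qed
      then show ?thesis by (simp add: grid_nbhd_def)
    next
      case False
      with le have "y \<in> cube x (mesh \<rho> k)" by (simp add: cube_def d_def infnorm_sub)
      then show ?thesis using cube_subset_grid_nbhd[OF mesh_pos[OF \<rho>]] by blast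
    qed
    then have "riesz_kernel \<alpha> \<rho> (x - y) \<le> ennreal (2 powr - \<beta>)
        * (\<Sum>k\<in>{k}. ennreal (mesh \<rho> k powr \<beta>) * indicator (grid_nbhd (mesh \<rho> k) x) y)"
      using half[OF mesh_pos[OF \<rho>], of k] j k mesh_Suc[of \<rho> k] 4 \<rho>
      by (simp add: riesz_kernel_def d_def[symmetric] \<beta>_def[symmetric] ennreal_leI flip: ennreal_mult)
    also have "\<dots> \<le> ennreal (2 powr - \<beta>) * ?S"
      by (intro mult_left_mono sum_le_suminf) auto
    also have "\<dots> \<le> ennreal (2 powr - \<beta>) * (ennreal (\<rho> powr \<beta>) * indicator (cube x \<rho>) y + ?S)"
      by (intro mult_left_mono) auto
    finally show ?thesis .
  qed
qed

lemma riesz_potential_le: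
  fixes x :: "real ^ 'n"
  assumes \<alpha>: "\<alpha> < real CARD('n)" and \<rho>: "0 < \<rho>" and \<mu>: "sets \<mu> = sets borel"
  defines "\<beta> \<equiv> \<alpha> - real CARD('n)"
  shows "riesz_potential \<alpha> \<rho> \<mu> x \<le> ennreal (2 powr - \<beta>) * (ennreal (\<rho> powr \<beta>) * emeasure \<mu> (cube x \<rho>)
    + (\<Sum>k. ennreal (mesh \<rho> k powr \<beta>) * emeasure \<mu> (grid_nbhd (mesh \<rho> k) x)))"
proof -
  have [measurable_cong]: "sets \<mu> = sets borel" by fact
  have "riesz_potential \<alpha> \<rho> \<mu> x \<le> (\<integral>\<^sup>+y. ennreal (2 powr - \<beta>) * (ennreal (\<rho> powr \<beta>) * indicator (cube x \<rho>) y
    + (\<Sum>k. ennreal (mesh \<rho> k powr \<beta>) * indicator (grid_nbhd (mesh \<rho> k) x) y)) \<partial>\<mu>)"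
    unfolding riesz_potential_def \<beta>_def by (intro nn_integral_mono riesz_kernel_le \<alpha> \<rho>)
  also have "\<dots> = ennreal (2 powr - \<beta>) * (ennreal (\<rho> powr \<beta>) * emeasure \<mu> (cube x \<rho>)
    + (\<Sum>k. ennreal (mesh \<rho> k powr \<beta>) * emeasure \<mu> (grid_nbhd (mesh \<rho> k) x)))"
    by (simp add: nn_integral_cmult nn_integral_add nn_integral_suminf nn_integral_cmult_indicator \<mu>)
  finally show ?thesis .
qed

section \<open>The grid sum and the maximal function\<close>

lemma two_powr_minus_less_one: "0 < \<alpha> \<Longrightarrow> 2 powr - \<alpha> < (1 :: real)"
  using powr_less_mono[of "- \<alpha>" 0 2] by simp

text \<open>A geometric series of ratio \<open>2 powr - \<alpha>\<close>, which is below 1 because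
  \<open>\<alpha> > 0\<close>; hence the coarsest scale controls the sum.\<close>

lemma sum_mesh_powr_le:
  assumes "0 < \<alpha>" "0 < \<rho>" "m \<le> N"
  shows "(\<Sum>k=m..<N. mesh \<rho> k powr \<alpha>) \<le> 1 / (1 - 2 powr - \<alpha>) * mesh \<rho> m powr \<alpha>"
proof -
  define r where "r = 2 powr - \<alpha>"
  have q: "r < 1" unfolding r_def using assms by (simp add: two_powr_minus_less_one)
  have Suc: "mesh \<rho> (Suc k) powr \<alpha> = r * mesh \<rho> k powr \<alpha>" for k
    using mesh_pos[OF assms(2)] by (simp add: r_def mesh_Suc[of \<rho> k] powr_mult powr_minus)
  have "(\<Sum>k=m..<N. mesh \<rho> k powr \<alpha>) = (mesh \<rho> m powr \<alpha> - mesh \<rho> N powr \<alpha>) / (1 - r)"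
    using assms(3)
  proof (induction N rule: dec_induct)
    case (step n)
    then have "(\<Sum>k=m..<Suc n. mesh \<rho> k powr \<alpha>)
        = (mesh \<rho> m powr \<alpha> - mesh \<rho> n powr \<alpha>) / (1 - r) + mesh \<rho> n powr \<alpha>" by simp
    also have "\<dots> = (mesh \<rho> m powr \<alpha> - mesh \<rho> (Suc n) powr \<alpha>) / (1 - r)"
      using q by (simp add: Suc field_simps)
    finally show ?case .
  qed simp
  also have "\<dots> \<le> mesh \<rho> m powr \<alpha> / (1 - r)"
    using q by (intro divide_right_mono) auto
  finally show ?thesis by (simp add: r_def)
qed

lemma grid_nbhd_eq_index: "grid_nbhd l x = {y. \<forall>i. \<bar>\<lfloor>y $ i / l\<rfloor> - grid_index l x $ i\<bar> \<le> 1}"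
  by (simp add: grid_nbhd_def grid_index_def)

text \<open>The neighbourhood is a function of the index, which lives in a countable discrete space,
  so every \<open>h\<close> yields a measurable function.\<close>

lemma grid_nbhd_fun_measurable:
  "(\<lambda>x :: real ^ 'n. h (grid_nbhd l x)) \<in> borel_measurable borel" for h :: "_ \<Rightarrow> 'b :: topological_space"
  unfolding grid_nbhd_eq_index
  by (rule measurable_compose[OF grid_index_measurable[of l]]) simp

lemma countable_range_grid_nbhd: "countable (range (grid_nbhd l :: real ^ 'n \<Rightarrow> _))"
proof -
  have "range (grid_nbhd l :: real ^ 'n \<Rightarrow> _) \<subseteq> range (\<lambda>c :: int ^ 'n. {y. \<forall>i. \<bar>\<lfloor>y $ i / l\<rfloor> - c $ i\<bar> \<le> 1})"
    unfolding grid_nbhd_eq_index by auto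
  then show ?thesis by (rule countable_subset) simp
qed

text \<open>Countably many distinct neighbourhoods cover the space. Sigma-finiteness is what
  Fubini's theorem asks of \<open>\<mu>\<close>.\<close>

lemma sigma_finite_if_grid_nbhd_finite:
  fixes \<mu> :: "(real ^ 'n) measure"
  assumes "sets \<mu> = sets borel" "\<And>x. emeasure \<mu> (grid_nbhd l x) < \<infinity>"
  shows "sigma_finite_measure \<mu>"
proof
  have "space \<mu> = UNIV" using sets_eq_imp_space_eq[OF assms(1)] by simp
  moreover have "x \<in> \<Union> (range (grid_nbhd l))" for x :: "real ^ 'n"
    using grid_nbhd_refl by blast
  ultimately show "\<exists>A. countable A \<and> A \<subseteq> sets \<mu> \<and> \<Union>A = space \<mu> \<and> (\<forall>a\<in>A. emeasure \<mu> a \<noteq> \<infinity>)"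
    using assms countable_range_grid_nbhd[of l]
    by (intro exI[of _ "range (grid_nbhd l)"]) (auto simp: less_top)
qed

lemma weight_cube_finite:
  fixes \<omega> :: "real ^ 'n \<Rightarrow> real"
  assumes "weight \<omega>"
  shows "emeasure (density lebesgue (\<lambda>y. ennreal (\<omega> y))) (cube x r) < \<infinity>"
proof -
  let ?K = "cbox (\<chi> i. x $ i - r) (\<chi> i. x $ i + r)"
  have "emeasure (density lebesgue (\<lambda>y. ennreal (\<omega> y))) (cube x r)
    \<le> emeasure (density lebesgue (\<lambda>y. ennreal (\<omega> y))) ?K"
    unfolding cube_eq_box by (intro emeasure_mono box_subset_cbox) auto
  also have "\<dots> = ennreal (LINT y:?K|lebesgue. \<omega> y)"
    using assms weight_measurable[OF assms]
    by (intro emeasure_density_eq_set_integral) (auto simp: weight_def)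
  finally show ?thesis by (simp add: le_less_trans)
qed

lemma grid_nbhd_mass_le_frac_maximal:
  fixes \<mu> :: "(real ^ 'n) measure"
  assumes \<rho>: "0 < \<rho>" and \<mu>: "sets \<mu> = sets borel"
  shows "ennreal ((2 * mesh \<rho> k) powr (\<alpha> - real CARD('n))) * emeasure \<mu> (grid_nbhd (mesh \<rho> k) y)
    \<le> frac_maximal \<alpha> \<rho> \<mu> y"
proof -
  have l: "0 < mesh \<rho> k" using \<rho> by (rule mesh_pos)
  have "ennreal ((2 * mesh \<rho> k) powr (\<alpha> - real CARD('n))) * emeasure \<mu> (grid_nbhd (mesh \<rho> k) y)
    \<le> ennreal ((2 * mesh \<rho> k) powr (\<alpha> - real CARD('n))) * emeasure \<mu> (cube y (2 * mesh \<rho> k))"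
    using grid_nbhd_subset_cube[OF l, of y] by (auto intro!: mult_left_mono emeasure_mono simp: \<mu>)
  also have "\<dots> \<le> frac_maximal \<alpha> \<rho> \<mu> y"
    using l mesh_le[OF \<rho>, of k] by (intro riesz_factor_le_frac_maximal) auto
  finally show ?thesis .
qed

text \<open>Over a cell of generation \<open>m\<close>, all neighbourhoods of generation
  \<open>k \<ge> m\<close> lie in that of generation \<open>m\<close>.
  \<open>nn_integral_grid_nbhd_le\<close> then bounds the integral of \<open>a k\<close> by its mass
  times \<open>4 ^ CARD('n) * mesh \<rho> k powr \<alpha>\<close>: the volume factor raises the
  exponent from \<open>\<alpha> - n\<close> to \<open>\<alpha>\<close>, and
  \<open>sum_mesh_powr_le\<close> sums over \<open>k\<close>.\<close>

lemma grid_carleson: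
  fixes \<mu> :: "(real ^ 'n) measure"
  assumes \<alpha>: "0 < \<alpha>" and \<rho>: "0 < \<rho>" and \<mu>: "sets \<mu> = sets borel"
    and fin: "\<And>k x. emeasure \<mu> (grid_nbhd (mesh \<rho> k) x) < \<infinity>" and m: "m < N"
  defines "a \<equiv> \<lambda>k x. mesh \<rho> k powr (\<alpha> - real CARD('n)) * measure \<mu> (grid_nbhd (mesh \<rho> k) x)"
  defines "c \<equiv> \<lambda>x. {y. grid_index (mesh \<rho> m) y = grid_index (mesh \<rho> m) x}"
  shows "(\<integral>\<^sup>+y. ennreal (\<Sum>k=m..<N. a k y) * indicator (c x) y \<partial>lebesgue)
    \<le> ennreal (4 ^ CARD('n) / (1 - 2 powr - \<alpha>) * a m x) * emeasure lebesgue (c x)"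
proof -
  let ?n = "CARD('n)" and ?T = "grid_nbhd (mesh \<rho> m) x"
  define \<beta> where "\<beta> = \<alpha> - real ?n"
  have sf: "sigma_finite_measure \<mu>" using \<mu> fin by (rule sigma_finite_if_grid_nbhd_finite)
  have a_eq: "ennreal (a k y) = ennreal (mesh \<rho> k powr \<beta>) * emeasure \<mu> (grid_nbhd (mesh \<rho> k) y)" for k y
    using fin[of k y] by (simp add: a_def \<beta>_def ennreal_mult emeasure_eq_ennreal_measure less_top)
  have [measurable]: "c x \<in> sets borel" unfolding c_def by measurable
  have [measurable]: "(\<lambda>y. emeasure \<mu> (grid_nbhd l y)) \<in> borel_measurable borel" for l
    by (rule grid_nbhd_fun_measurable)
  have level: "(\<integral>\<^sup>+y. ennreal (a k y) * indicator (c x) y \<partial>lborel)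
    \<le> ennreal (4 ^ ?n * mesh \<rho> k powr \<alpha>) * emeasure \<mu> ?T" if k: "m \<le> k" for k
  proof -
    have l: "0 < mesh \<rho> k" using \<rho> by (rule mesh_pos)
    have "(\<integral>\<^sup>+y. ennreal (a k y) * indicator (c x) y \<partial>lborel)
      = ennreal (mesh \<rho> k powr \<beta>) * (\<integral>\<^sup>+y. emeasure \<mu> (grid_nbhd (mesh \<rho> k) y) * indicator (c x) y \<partial>lborel)"
      unfolding a_eq mult.assoc by (rule nn_integral_cmult) measurable
    also have "\<dots> \<le> ennreal (mesh \<rho> k powr \<beta>) * (ennreal ((4 * mesh \<rho> k) ^ ?n) * emeasure \<mu> ?T)"
    proof (intro mult_left_mono nn_integral_grid_nbhd_le sf \<mu> l)
      show "grid_nbhd (mesh \<rho> k) y \<subseteq> ?T" if "y \<in> c x" for y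
        using grid_nbhd_mesh_mono[OF k, of \<rho> y] grid_nbhd_cong[of "mesh \<rho> m" y x] that by (simp add: c_def)
    qed auto
    also have "\<dots> = ennreal (mesh \<rho> k powr \<beta> * (4 * mesh \<rho> k) ^ ?n) * emeasure \<mu> ?T"
      using l by (simp add: ennreal_mult mult.assoc)
    also have "mesh \<rho> k powr \<beta> * (4 * mesh \<rho> k) ^ ?n = 4 ^ ?n * mesh \<rho> k powr \<alpha>"
      using l by (simp add: \<beta>_def power_mult_distrib powr_diff powr_realpow)
    finally show ?thesis .
  qed
  have a_nonneg: "0 \<le> a k y" for k y by (simp add: a_def)
  have q: "2 powr - \<alpha> < 1" using \<alpha> by (simp add: two_powr_minus_less_one)
  have "(\<integral>\<^sup>+y. ennreal (\<Sum>k=m..<N. a k y) * indicator (c x) y \<partial>lebesgue)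
    = (\<integral>\<^sup>+y. (\<Sum>k=m..<N. ennreal (a k y) * indicator (c x) y) \<partial>lborel)"
    unfolding nn_integral_completion using a_nonneg by (intro nn_integral_cong) (simp flip: sum_distrib_right)
  also have "\<dots> = (\<Sum>k=m..<N. \<integral>\<^sup>+y. ennreal (a k y) * indicator (c x) y \<partial>lborel)"
    unfolding a_eq by (rule nn_integral_sum) measurable
  also have "\<dots> \<le> (\<Sum>k=m..<N. ennreal (4 ^ ?n * mesh \<rho> k powr \<alpha>) * emeasure \<mu> ?T)"
    by (intro sum_mono level) auto
  also have "\<dots> = ennreal (4 ^ ?n * (\<Sum>k=m..<N. mesh \<rho> k powr \<alpha>)) * emeasure \<mu> ?T"
    by (simp add: sum_distrib_right[symmetric] sum_ennreal sum_distrib_left)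
  also have "\<dots> \<le> ennreal (4 ^ ?n * (1 / (1 - 2 powr - \<alpha>) * mesh \<rho> m powr \<alpha>)) * emeasure \<mu> ?T"
    using sum_mesh_powr_le[OF \<alpha> \<rho>, of m N] m by (intro mult_right_mono ennreal_leI mult_left_mono) auto
  also have "\<dots> = ennreal (4 ^ ?n / (1 - 2 powr - \<alpha>) * a m x) * emeasure lebesgue (c x)"
  proof -
    have l: "0 < mesh \<rho> m" using \<rho> by (rule mesh_pos)
    have "emeasure lebesgue (c x) = ennreal (mesh \<rho> m ^ ?n)"
      using l unfolding c_def by (simp add: emeasure_grid_cell)
    moreover have "emeasure \<mu> ?T = ennreal (measure \<mu> ?T)"
      using fin[of m x] by (simp add: emeasure_eq_ennreal_measure less_top)
    \<comment> \<open>Splitting off the volume of the cell leaves exactly the power that occurs in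
      \<open>a m x\<close>.\<close>
    moreover have "mesh \<rho> m powr \<alpha> = mesh \<rho> m powr \<beta> * mesh \<rho> m ^ ?n"
      using l by (simp add: \<beta>_def powr_diff powr_realpow)
    ultimately show ?thesis
      using q a_nonneg[of m x] l by (simp add: a_def \<beta>_def[symmetric] mult_ac flip: ennreal_mult)
  qed
  finally show ?thesis .
qed

text \<open>\<open>sum_le_maximal\<close> treats the finite partial sums uniformly in
  \<open>N\<close>, with \<open>A\<close> from \<open>grid_carleson\<close>, and monotone
  convergence gives the series. The factor \<open>(2 powr - \<beta>) powr p\<close> arises because
  the neighbourhood at side \<open>l\<close> is placed in a cube of radius
  \<open>2 * l\<close>.\<close>

lemma grid_sum_le_frac_maximal:
  fixes \<mu> :: "(real ^ 'n) measure" and \<omega> :: "real ^ 'n \<Rightarrow> real"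
  assumes \<alpha>: "0 < \<alpha>" and p: "0 < p" and \<rho>: "0 < \<rho>"
    and \<omega>: "\<omega> \<in> Ainf_loc \<rho>" and \<mu>: "sets \<mu> = sets borel"
    and fin: "\<And>k x. emeasure \<mu> (grid_nbhd (mesh \<rho> k) x) < \<infinity>"
  defines "\<beta> \<equiv> \<alpha> - real CARD('n)"
  defines "C \<equiv> good_lambda_const (Ainf_ratio (Ainf_loc_const \<rho> \<omega>)) (4 ^ CARD('n) / (1 - 2 powr - \<alpha>)) p"
  shows "(\<integral>\<^sup>+x. ennpowr (\<Sum>k. ennreal (mesh \<rho> k powr \<beta>) * emeasure \<mu> (grid_nbhd (mesh \<rho> k) x)) p * ennreal (\<omega> x) \<partial>lebesgue)
    \<le> ennreal C * (ennreal ((2 powr - \<beta>) powr p) * (\<integral>\<^sup>+x. ennpowr (frac_maximal \<alpha> \<rho> \<mu> x) p * ennreal (\<omega> x) \<partial>lebesgue))"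
    (is "?L \<le> ennreal C * ?R")
proof -
  have w: "weight \<omega>" using \<omega> by (simp add: Ainf_loc_def)
  have [measurable]: "\<omega> \<in> borel_measurable lebesgue" using w by (rule weight_measurable)
  have l: "0 < mesh \<rho> k" "mesh \<rho> k \<le> \<rho>" for k
    using mesh_pos[OF \<rho>, of k] mesh_le[OF \<rho>, of k] by auto
  define W where "W = density lebesgue (\<lambda>y. ennreal (\<omega> y))"
  define a where "a k x = mesh \<rho> k powr \<beta> * measure \<mu> (grid_nbhd (mesh \<rho> k) x)" for k x
  have a_eq: "ennreal (a k y) = ennreal (mesh \<rho> k powr \<beta>) * emeasure \<mu> (grid_nbhd (mesh \<rho> k) y)" for k y
    using fin[of k y] by (simp add: a_def ennreal_mult emeasure_eq_ennreal_measure less_top)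
  have a_nonneg: "0 \<le> a k y" for k y by (simp add: a_def)
  have "a k \<in> borel_measurable borel" for k
    unfolding a_def by (rule grid_nbhd_fun_measurable)
  then have [measurable]: "a k \<in> borel_measurable lebesgue" for k
    by (simp add: measurable_completion)
  have [simp]: "sets W = sets lebesgue" by (simp add: W_def)
  have [measurable]: "a k \<in> borel_measurable W" for k by (simp add: W_def)
  interpret nested_partitions lebesgue W "\<lambda>k. grid_index (mesh \<rho> k)" "Ainf_ratio (Ainf_loc_const \<rho> \<omega>)"
  proof
    show "grid_index (mesh \<rho> k) \<in> lebesgue \<rightarrow>\<^sub>M count_space UNIV" for k
      by (rule measurable_completion) simp
    show "grid_index (mesh \<rho> k) x = grid_index (mesh \<rho> k) y"
      if "grid_index (mesh \<rho> (Suc k)) x = grid_index (mesh \<rho> (Suc k)) y" for k x y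
      using that by (rule grid_index_mesh_mono[rotated]) simp
    show "emeasure W {y. grid_index (mesh \<rho> k) y = grid_index (mesh \<rho> k) x} < \<infinity>" for k x
    proof (rule le_less_trans[OF emeasure_mono weight_cube_finite[OF w, folded W_def]])
      have "y \<in> grid_nbhd (mesh \<rho> k) x" if "grid_index (mesh \<rho> k) y = grid_index (mesh \<rho> k) x" for y
        using grid_nbhd_cong[OF that] grid_nbhd_refl[of y "mesh \<rho> k"] by simp
      then show "{y. grid_index (mesh \<rho> k) y = grid_index (mesh \<rho> k) x} \<subseteq> cube x (2 * mesh \<rho> k)"
        using grid_nbhd_subset_cube[OF l(1)[of k], of x] by blast
    qed (simp add: open_cube)
    show "emeasure W E \<le> ennreal (Ainf_ratio (Ainf_loc_const \<rho> \<omega>))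
        * emeasure W {y. grid_index (mesh \<rho> k) y = grid_index (mesh \<rho> k) x}"
      if "E \<in> sets lebesgue" "E \<subseteq> {y. grid_index (mesh \<rho> k) y = grid_index (mesh \<rho> k) x}"
        "2 * emeasure lebesgue E \<le> emeasure lebesgue {y. grid_index (mesh \<rho> k) y = grid_index (mesh \<rho> k) x}" for k x E
      unfolding W_def using \<omega> l that by (rule Ainf_loc_half_grid)
  qed (simp_all add: Ainf_ratio_bounds)
  have level: "(\<integral>\<^sup>+y. ennreal ((\<Sum>k<N. a k y) powr p) \<partial>W) \<le> ennreal C * ?R" for N
  proof -
    \<comment> \<open>\<open>sum_le_maximal\<close> asks for a real-valued measurable majorant; the
      maximum of finitely many \<open>a k\<close> is one, and it lies below a multiple of
      \<open>frac_maximal\<close>. The range \<open>{..N}\<close> is nonempty even for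
      \<open>N = 0\<close>.\<close>
    define g where "g y = Max ((\<lambda>k. a k y) ` {..N})" for y
    have g_ge: "a k y \<le> g y" if "k < N" for k y
      unfolding g_def using that by (intro Max_ge) auto
    have g_in: "\<exists>k. g y = a k y" for y
    proof -
      have "g y \<in> (\<lambda>k. a k y) ` {..N}" unfolding g_def by (rule Max_in) auto
      then show ?thesis by blast
    qed
    have [measurable]: "g \<in> borel_measurable lebesgue"
      unfolding g_def by measurable
    have "(\<integral>\<^sup>+y. ennreal ((\<Sum>k<N. a k y) powr p) \<partial>W) \<le> ennreal C * (\<integral>\<^sup>+y. ennreal (g y powr p) \<partial>W)"
      unfolding C_def
    proof (rule sum_le_maximal)
      show "(\<integral>\<^sup>+y. ennreal (\<Sum>k=m..<N. a k y) * indicator {y. grid_index (mesh \<rho> m) y = grid_index (mesh \<rho> m) x} y \<partial>lebesgue)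
        \<le> ennreal (4 ^ CARD('n) / (1 - 2 powr - \<alpha>) * a m x)
          * emeasure lebesgue {y. grid_index (mesh \<rho> m) y = grid_index (mesh \<rho> m) x}" if "m < N" for m x
        using grid_carleson[OF \<alpha> \<rho> \<mu> fin that, of x] unfolding a_def \<beta>_def .
      show "0 < 4 ^ CARD('n) / (1 - 2 powr - \<alpha>)" using \<alpha> by (simp add: two_powr_minus_less_one)
      \<comment> \<open>All finer neighbourhoods lie in the one of generation 0, whose mass is
        finite; for fixed \<open>N\<close> this bounds the sum on the whole cell.\<close>
      show "\<exists>B. \<forall>y. grid_index (mesh \<rho> 0) y = grid_index (mesh \<rho> 0) x \<longrightarrow> (\<Sum>k<N. a k y) \<le> B" for x
      proof (intro exI[of _ "\<Sum>k<N. mesh \<rho> k powr \<beta> * measure \<mu> (grid_nbhd (mesh \<rho> 0) x)"] allI impI sum_mono)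
        fix y k assume y: "grid_index (mesh \<rho> 0) y = grid_index (mesh \<rho> 0) x"
        have "grid_nbhd (mesh \<rho> k) y \<subseteq> grid_nbhd (mesh \<rho> 0) x"
          using grid_nbhd_mesh_mono[of 0 k \<rho> y] grid_nbhd_cong[OF y] by simp
        then have "measure \<mu> (grid_nbhd (mesh \<rho> k) y) \<le> measure \<mu> (grid_nbhd (mesh \<rho> 0) x)"
          unfolding measure_def using fin[of 0 x] by (intro enn2real_mono emeasure_mono) (auto simp: \<mu>)
        then show "a k y \<le> mesh \<rho> k powr \<beta> * measure \<mu> (grid_nbhd (mesh \<rho> 0) x)"
          unfolding a_def by (intro mult_left_mono) auto
      qed
      show "0 \<le> g y" for y using g_in[of y] a_nonneg by auto
      show "a k x = a k y" if "grid_index (mesh \<rho> k) x = grid_index (mesh \<rho> k) y" for k x y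
        unfolding a_def using grid_nbhd_cong[OF that] by simp
    qed (use p a_nonneg g_ge in auto)
    also have "(\<integral>\<^sup>+y. ennreal (g y powr p) \<partial>W) = (\<integral>\<^sup>+y. ennreal (\<omega> y) * ennreal (g y powr p) \<partial>lebesgue)"
      unfolding W_def by (rule nn_integral_density) measurable
    also have "\<dots> = (\<integral>\<^sup>+y. ennreal ((2 powr - \<beta>) powr p) * (ennreal ((2 powr \<beta> * g y) powr p) * ennreal (\<omega> y)) \<partial>lebesgue)"
    proof (rule nn_integral_cong)
      fix y
      have "0 \<le> g y" using g_in[of y] a_nonneg by auto
      then have "g y powr p = (2 powr - \<beta>) powr p * (2 powr \<beta> * g y) powr p"
        by (simp add: powr_mult[symmetric] powr_minus flip: mult.assoc)
      then show "ennreal (\<omega> y) * ennreal (g y powr p)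
        = ennreal ((2 powr - \<beta>) powr p) * (ennreal ((2 powr \<beta> * g y) powr p) * ennreal (\<omega> y))"
        by (simp add: ennreal_mult mult_ac)
    qed
    also have "\<dots> = ennreal ((2 powr - \<beta>) powr p) * (\<integral>\<^sup>+y. ennreal ((2 powr \<beta> * g y) powr p) * ennreal (\<omega> y) \<partial>lebesgue)"
      by (rule nn_integral_cmult) measurable
    also have "\<dots> \<le> ?R"
    proof (intro mult_left_mono nn_integral_mono mult_right_mono)
      fix y
      obtain k where k: "g y = a k y" using g_in by blast
      have "ennreal (2 powr \<beta> * g y) = ennreal ((2 * mesh \<rho> k) powr \<beta>) * emeasure \<mu> (grid_nbhd (mesh \<rho> k) y)"
        using l[of k] a_nonneg by (simp add: k ennreal_mult a_eq powr_mult mult.assoc)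
      also have "\<dots> \<le> frac_maximal \<alpha> \<rho> \<mu> y"
        unfolding \<beta>_def by (rule grid_nbhd_mass_le_frac_maximal[OF \<rho> \<mu>])
      finally have "ennpowr (ennreal (2 powr \<beta> * g y)) p \<le> ennpowr (frac_maximal \<alpha> \<rho> \<mu> y) p"
        using p by (rule ennpowr_mono)
      then show "ennreal ((2 powr \<beta> * g y) powr p) \<le> ennpowr (frac_maximal \<alpha> \<rho> \<mu> y) p"
        using a_nonneg by (simp add: k ennpowr_ennreal)
    qed auto
    finally show ?thesis by (simp add: mult_left_mono)
  qed
  have [measurable]: "(\<lambda>x. \<Sum>k. ennreal (a k x)) \<in> borel_measurable lebesgue" by measurable
  have "?L = (\<integral>\<^sup>+x. ennpowr (\<Sum>k. ennreal (a k x)) p \<partial>W)"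
    unfolding a_eq[symmetric] W_def by (subst nn_integral_density) (auto simp: mult.commute)
  also have "\<dots> \<le> (\<integral>\<^sup>+x. (SUP N. ennreal ((\<Sum>k<N. a k x) powr p)) \<partial>W)"
  proof (rule nn_integral_mono)
    fix x
    have "ennpowr (\<Sum>k. ennreal (a k x)) p \<le> (SUP N. ennpowr (\<Sum>k<N. ennreal (a k x)) p)"
      unfolding suminf_eq_SUP using p by (rule ennpowr_SUP_le)
    also have "\<dots> = (SUP N. ennreal ((\<Sum>k<N. a k x) powr p))"
      using a_nonneg by (simp add: sum_ennreal ennpowr_ennreal sum_nonneg)
    finally show "ennpowr (\<Sum>k. ennreal (a k x)) p \<le> (SUP N. ennreal ((\<Sum>k<N. a k x) powr p))" .
  qed
  also have "\<dots> = (SUP N. (\<integral>\<^sup>+x. ennreal ((\<Sum>k<N. a k x) powr p) \<partial>W))"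
  proof (rule nn_integral_monotone_convergence_SUP)
    show "incseq (\<lambda>N x. ennreal ((\<Sum>k<N. a k x) powr p))"
      using a_nonneg p by (intro incseq_SucI le_funI ennreal_leI powr_mono2) (auto intro: sum_nonneg)
  qed measurable
  also have "\<dots> \<le> ennreal C * ?R" by (intro SUP_least level)
  finally show ?thesis .
qed

text \<open>A neighbourhood of infinite mass is shared by all points of a grid cell, so the maximal
  function is infinite on that cell. The cell has positive Lebesgue measure and
  \<open>\<omega> > 0\<close> almost everywhere, hence its weight is positive.\<close>

lemma frac_maximal_integral_top:
  fixes \<mu> :: "(real ^ 'n) measure" and \<omega> :: "real ^ 'n \<Rightarrow> real"
  assumes \<rho>: "0 < \<rho>" and \<omega>: "weight \<omega>" and \<mu>: "sets \<mu> = sets borel"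
    and inf: "emeasure \<mu> (grid_nbhd (mesh \<rho> k) x) = \<infinity>"
  shows "(\<integral>\<^sup>+y. ennpowr (frac_maximal \<alpha> \<rho> \<mu> y) p * ennreal (\<omega> y) \<partial>lebesgue) = \<infinity>"
proof -
  define c where "c = {y. grid_index (mesh \<rho> k) y = grid_index (mesh \<rho> k) x}"
  have l: "0 < mesh \<rho> k" using \<rho> by (rule mesh_pos)
  have [measurable]: "\<omega> \<in> borel_measurable lebesgue" "c \<in> sets lebesgue"
    using \<omega> by (simp_all add: weight_measurable c_def)
  have top: "frac_maximal \<alpha> \<rho> \<mu> y = \<infinity>" if "y \<in> c" for y
  proof -
    have "emeasure \<mu> (grid_nbhd (mesh \<rho> k) y) = \<infinity>"
      using that inf grid_nbhd_cong[of "mesh \<rho> k" y x] by (simp add: c_def)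
    then have "\<infinity> = ennreal ((2 * mesh \<rho> k) powr (\<alpha> - real CARD('n))) * emeasure \<mu> (grid_nbhd (mesh \<rho> k) y)"
      using l by (simp add: ennreal_mult_top)
    also have "\<dots> \<le> frac_maximal \<alpha> \<rho> \<mu> y" by (rule grid_nbhd_mass_le_frac_maximal[OF \<rho> \<mu>])
    finally show ?thesis by (simp add: top_unique)
  qed
  have "(\<integral>\<^sup>+y. ennreal (\<omega> y) * indicator c y \<partial>lebesgue) \<noteq> 0"
  proof
    assume "(\<integral>\<^sup>+y. ennreal (\<omega> y) * indicator c y \<partial>lebesgue) = 0"
    then have "AE y in lebesgue. ennreal (\<omega> y) * indicator c y = 0"
      by (subst (asm) nn_integral_0_iff_AE) auto
    moreover have "AE y in lebesgue. 0 < \<omega> y" using \<omega> by (simp add: weight_def)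
    ultimately have "AE y in lebesgue. y \<notin> c" by eventually_elim (auto simp: indicator_def split: if_splits)
    then have "emeasure lebesgue c = 0" by (subst (asm) AE_iff_measurable[of c]) auto
    then show False using l by (simp add: c_def emeasure_grid_cell)
  qed
  then have "\<infinity> = \<infinity> * (\<integral>\<^sup>+y. ennreal (\<omega> y) * indicator c y \<partial>lebesgue)"
    by (simp add: ennreal_top_mult)
  also have "\<dots> = (\<integral>\<^sup>+y. \<infinity> * (ennreal (\<omega> y) * indicator c y) \<partial>lebesgue)"
    by (rule nn_integral_cmult[symmetric]) measurable
  also have "\<dots> \<le> (\<integral>\<^sup>+y. ennpowr (frac_maximal \<alpha> \<rho> \<mu> y) p * ennreal (\<omega> y) \<partial>lebesgue)"
    by (intro nn_integral_mono) (auto simp: top indicator_def)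
  finally show ?thesis by (simp add: top_unique)
qed

section \<open>The weighted inequality between potential and maximal function\<close>

theorem proposition3p3p2:
  fixes \<alpha> p :: real
  assumes "0 < \<alpha>" and "\<alpha> < real CARD('n::finite)" and "0 < p"
  shows "\<exists>C :: ennreal \<Rightarrow> real. (\<forall>t. 0 < C t) \<and>
    (\<forall>\<rho> (\<omega> :: real ^ 'n \<Rightarrow> real) (\<mu> :: (real ^ 'n) measure).
       0 < \<rho> \<longrightarrow> \<omega> \<in> Ainf_loc \<rho> \<longrightarrow> sets \<mu> = sets borel \<longrightarrow>
       (\<integral>\<^sup>+ x. ennpowr (riesz_potential \<alpha> \<rho> \<mu> x) p * ennreal (\<omega> x) \<partial>lebesgue)
       \<le> ennreal (C (Ainf_loc_const \<rho> \<omega>)) *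
          (\<integral>\<^sup>+ x. ennpowr (frac_maximal \<alpha> \<rho> \<mu> x) p * ennreal (\<omega> x) \<partial>lebesgue))"
proof -
  define \<beta> where "\<beta> = \<alpha> - real CARD('n)"
  \<comment> \<open>\<open>D\<close> collects the p-th power of the factor in
    \<open>riesz_potential_le\<close> and the loss in \<open>ennpowr_add_le\<close>.\<close>
  define D where "D = (2 powr - \<beta>) powr p * 2 powr p"
  define C1 where "C1 t = good_lambda_const (Ainf_ratio t) (4 ^ CARD('n) / (1 - 2 powr - \<alpha>)) p" for t
  \<comment> \<open>The summand 1 accounts for the term with \<open>cube x \<rho>\<close>, the other
    for the grid sum; the absolute value yields positivity of \<open>C t\<close> whatever the sign
    of \<open>C1 t\<close>. The radius \<open>\<rho>\<close> enters only through
    \<open>t\<close>.\<close>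
  define C where "C t = D * (1 + \<bar>C1 t\<bar> * (2 powr - \<beta>) powr p)" for t
  have D: "0 < D" by (simp add: D_def)
  have C: "0 < C t" for t unfolding C_def using D by (intro mult_pos_pos add_pos_nonneg) auto
  have "(\<integral>\<^sup>+ x. ennpowr (riesz_potential \<alpha> \<rho> \<mu> x) p * ennreal (\<omega> x) \<partial>lebesgue)
       \<le> ennreal (C (Ainf_loc_const \<rho> \<omega>)) *
          (\<integral>\<^sup>+ x. ennpowr (frac_maximal \<alpha> \<rho> \<mu> x) p * ennreal (\<omega> x) \<partial>lebesgue)"
    if \<rho>: "0 < \<rho>" and \<omega>: "\<omega> \<in> Ainf_loc \<rho>" and \<mu>: "sets \<mu> = sets borel"
    for \<rho> and \<omega> :: "real ^ 'n \<Rightarrow> real" and \<mu> :: "(real ^ 'n) measure"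
  proof -
    let ?R = "\<integral>\<^sup>+ x. ennpowr (frac_maximal \<alpha> \<rho> \<mu> x) p * ennreal (\<omega> x) \<partial>lebesgue"
    let ?t = "Ainf_loc_const \<rho> \<omega>"
    have w: "weight \<omega>" using \<omega> by (simp add: Ainf_loc_def)
    have [measurable]: "\<omega> \<in> borel_measurable lebesgue" using w by (rule weight_measurable)
    show ?thesis
    \<comment> \<open>A neighbourhood of infinite mass makes the right side infinite. Otherwise all
      masses are finite, as \<open>grid_sum_le_frac_maximal\<close> requires.\<close>
    proof (cases "\<exists>k x. emeasure \<mu> (grid_nbhd (mesh \<rho> k) x) = \<infinity>")
      case True
      then have "?R = \<infinity>" using frac_maximal_integral_top[OF \<rho> w \<mu>] by blast
      then show ?thesis using C[of ?t] by (simp add: ennreal_mult_top)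
    next
      case False
      then have fin: "emeasure \<mu> (grid_nbhd (mesh \<rho> k) x) < \<infinity>" for k x
        by (auto simp: less_top)
      define u where "u x = ennreal (\<rho> powr \<beta>) * emeasure \<mu> (cube x \<rho>)" for x
      define F where "F x = (\<Sum>k. ennreal (mesh \<rho> k powr \<beta>) * emeasure \<mu> (grid_nbhd (mesh \<rho> k) x))" for x
      have [measurable]: "(\<lambda>x. emeasure \<mu> (cube x \<rho>)) \<in> borel_measurable lebesgue"
        "(\<lambda>x. emeasure \<mu> (grid_nbhd (mesh \<rho> k) x)) \<in> borel_measurable lebesgue" for k
        using emeasure_cube_measurable[OF \<mu>] grid_nbhd_fun_measurable[of "emeasure \<mu>"]
        by (auto intro: measurable_completion)
      have [measurable]: "u \<in> borel_measurable lebesgue" "F \<in> borel_measurable lebesgue"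
        unfolding u_def F_def by measurable
      have "(\<integral>\<^sup>+ x. ennpowr (riesz_potential \<alpha> \<rho> \<mu> x) p * ennreal (\<omega> x) \<partial>lebesgue)
        \<le> (\<integral>\<^sup>+ x. ennreal D * (ennpowr (u x) p * ennreal (\<omega> x) + ennpowr (F x) p * ennreal (\<omega> x)) \<partial>lebesgue)"
      proof (rule nn_integral_mono)
        fix x
        have "ennpowr (riesz_potential \<alpha> \<rho> \<mu> x) p \<le> ennpowr (ennreal (2 powr - \<beta>) * (u x + F x)) p"
          using riesz_potential_le[OF assms(2) \<rho> \<mu>, of x] assms(3)
          unfolding u_def F_def \<beta>_def by (rule ennpowr_mono)
        also have "\<dots> = ennreal ((2 powr - \<beta>) powr p) * ennpowr (u x + F x) p"
          by (rule ennpowr_cmult) simp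
        also have "\<dots> \<le> ennreal ((2 powr - \<beta>) powr p) * (ennreal (2 powr p) * (ennpowr (u x) p + ennpowr (F x) p))"
          using assms(3) by (intro mult_left_mono ennpowr_add_le) auto
        also have "\<dots> = ennreal D * (ennpowr (u x) p + ennpowr (F x) p)"
          by (simp add: D_def ennreal_mult mult.assoc)
        finally show "ennpowr (riesz_potential \<alpha> \<rho> \<mu> x) p * ennreal (\<omega> x)
          \<le> ennreal D * (ennpowr (u x) p * ennreal (\<omega> x) + ennpowr (F x) p * ennreal (\<omega> x))"
          unfolding distrib_right[symmetric] mult.assoc[symmetric] by (rule mult_right_mono) simp
      qed
      also have "\<dots> = ennreal D * ((\<integral>\<^sup>+ x. ennpowr (u x) p * ennreal (\<omega> x) \<partial>lebesgue)
          + (\<integral>\<^sup>+ x. ennpowr (F x) p * ennreal (\<omega> x) \<partial>lebesgue))"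
        by (simp add: nn_integral_cmult nn_integral_add)
      also have "\<dots> \<le> ennreal D * (?R + ennreal \<bar>C1 ?t\<bar> * (ennreal ((2 powr - \<beta>) powr p) * ?R))"
      proof (intro mult_left_mono add_mono)
        show "(\<integral>\<^sup>+ x. ennpowr (u x) p * ennreal (\<omega> x) \<partial>lebesgue) \<le> ?R"
          unfolding u_def \<beta>_def using \<rho> assms(3)
          by (intro nn_integral_mono mult_right_mono ennpowr_mono riesz_factor_le_frac_maximal) auto
        have "(\<integral>\<^sup>+ x. ennpowr (F x) p * ennreal (\<omega> x) \<partial>lebesgue)
          \<le> ennreal (C1 ?t) * (ennreal ((2 powr - \<beta>) powr p) * ?R)"
          unfolding F_def C1_def \<beta>_def using assms(1,3) \<rho> \<omega> \<mu> fin by (rule grid_sum_le_frac_maximal)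
        also have "\<dots> \<le> ennreal \<bar>C1 ?t\<bar> * (ennreal ((2 powr - \<beta>) powr p) * ?R)"
          by (intro mult_right_mono ennreal_leI) auto
        finally show "(\<integral>\<^sup>+ x. ennpowr (F x) p * ennreal (\<omega> x) \<partial>lebesgue)
          \<le> ennreal \<bar>C1 ?t\<bar> * (ennreal ((2 powr - \<beta>) powr p) * ?R)" .
      qed auto
      also have "\<dots> = ennreal (C ?t) * ?R"
        using D by (simp add: C_def ennreal_mult ennreal_plus distrib_right mult.assoc)
      finally show ?thesis .
    qed
  qed
  then show ?thesis using C by blast
qed

end
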